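(* $V_x(\rho_1,\lambda_1,\mu_1)\simeq V_x(\rho_2,\lambda_2,\mu_2)$ as left $H$-modules if and only if there exists $0\le k<n$ such that $$\lambda_1=\lambda_2,\qquad\rho_1=\rho_2\chi^{-k},\qquad\mu_1=\mu_2+\rho_2([e]_k^\sigma).$$ Here $\rho_1,\rho_2\in\widehat{G}$ and $\lambda_1,\lambda_2,\mu_1,\mu_2\in\mathbb{K}$ with $\lambda_1,\lambda_2\neq0$.
   Context: $\mathbb{K}$ is an algebraically closed field of characteristic zero, $G$ is a finitely generated abelian group, $\widehat{G}$ is the group of homomorphisms $G\to\mathbb{K}^\times$, $\chi\in\widehat{G}$ has finite order $n$, and $b,c\in G$ satisfy $\chi(b)=\chi(c)$ and $bc\neq1$. Put $e=c^{-1}-b\in\mathbb{K}[G]$. $H=H(G,\chi,\chi^{-1},b,c,1)$ is (after replacing its second Ore variable $y$ by $c^{-1}y$) the algebra generated by $G,x,y$ subject to the relations of $G$ and $xg=\chi(g)gx$, $yg=\chi(g)^{-1}gy$ $(g\in G)$, $yx=xy+e$; it has $\mathbb{K}$-basis $\{gx^iy^j\mid g\in G,\ i,j\ge 0\}$. Let $\sigma:\mathbb{K}[G]\to\mathbb{K}[G]$ be the automorphism with $\sigma(g)=\chi(g)g$, and for $u\in\mathbb{K}[G]$ let $[u]_i^\sigma=\sum_{k=0}^{i-1}\sigma^{-k}(u)$ for $i\ge1$, $[u]_0^\sigma=0$. Characters $\rho\in\widehat{G}$ are extended to algebra maps $\rho:\mathbb{K}[G]\to\mathbb{K}$. For $\rho\in\widehat{G}$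 and $\lambda,\mu\in\mathbb{K}$ with $\lambda\ne0$, $V_x(\rho,\lambda,\mu)$ is the $n$-dimensional $H$-module with basis $\{v_0,\ldots,v_{n-1}\}$ and action: $x\cdot v_i=v_{i+1}$ for $0\le i\le n-2$, $x\cdot v_{n-1}=\lambda v_0$; $y\cdot v_0=\lambda^{-1}\mu v_{n-1}$, $y\cdot v_i=(\mu+\rho([e]_i^\sigma))v_{i-1}$ for $1\le i\le n-1$; $g\cdot v_i=\rho(\sigma^{-i}(g))v_i$ for $g\in G$ and $0\le i\le n-1$. *)

theory Defs
  imports
    "HOL-Algebra.Module"
    "HOL-Algebra.QuotRing"
    "HOL-Algebra.Multiplicative_Group"
    "HOL-Library.Poly_Mapping"
    "HOL-Computational_Algebra.Group_Closure"
    "HOL-Computational_Algebra.Polynomial"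
begin

text \<open>
  The abelian group \<open>G\<close> is a type of class \<^class>\<open>ab_group_add\<close>, hence written additively: \<open>b + c\<close> is
  the product \<open>bc\<close>, \<open>- c\<close> is \<open>c\<^sup>-\<^sup>1\<close> and \<open>0\<close> is the neutral element.  The group algebra \<open>K[G]\<close> is the
  convolution ring of finitely supported functions on \<open>G\<close>; \<open>Poly_Mapping.single g 1\<close> is the group
  element \<open>g\<close>.
\<close>

type_synonym ('g, 'k) group_algebra = "'g \<Rightarrow>\<^sub>0 'k"

definition finitely_generated :: "'g::ab_group_add itself \<Rightarrow> bool" where
  "finitely_generated _ \<longleftrightarrow> (\<exists>S::'g set. finite S \<and> group_closure S = UNIV)"

definition dual_group :: "('g::ab_group_add \<Rightarrow> 'k::field) monoid" where
  "dual_group =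
    \<lparr>carrier = {\<rho>. (\<forall>g. \<rho> g \<noteq> 0) \<and> (\<forall>g h. \<rho> (g + h) = \<rho> g * \<rho> h)},
     monoid.mult = (\<lambda>\<rho> \<rho>' g. \<rho> g * \<rho>' g),
     one = (\<lambda>_. 1)\<rparr>"

definition extend_char :: "('g \<Rightarrow> 'k::field) \<Rightarrow> ('g, 'k) group_algebra \<Rightarrow> 'k" where
  "extend_char \<rho> u = (\<Sum>g\<in>Poly_Mapping.keys u. Poly_Mapping.lookup u g * \<rho> g)"

text \<open>The linear map \<open>K[G] \<rightarrow> K[G]\<close> with \<open>g \<mapsto> \<chi>(g) g\<close>.\<close>

definition sigma :: "('g \<Rightarrow> 'k::field) \<Rightarrow> ('g, 'k) group_algebra \<Rightarrow> ('g, 'k) group_algebra" where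
  "sigma \<chi> = Poly_Mapping.mapp (\<lambda>g a. \<chi> g * a)"

definition sigma_bracket ::
  "('g \<Rightarrow> 'k::field) \<Rightarrow> nat \<Rightarrow> ('g, 'k) group_algebra \<Rightarrow> ('g, 'k) group_algebra" where
  "sigma_bracket \<chi> i u = (\<Sum>k<i. (inv_into UNIV (sigma \<chi>) ^^ k) u)"

definition e_elt :: "'g::ab_group_add \<Rightarrow> 'g \<Rightarrow> ('g, 'k::field) group_algebra" where
  "e_elt b c = Poly_Mapping.single (- c) 1 - Poly_Mapping.single b 1"


text \<open>
  \<open>H\<close> is presented by generators and relations.  Words in the generators form a free monoid, which
  carries additive notation because \<^typ>\<open>'m \<Rightarrow>\<^sub>0 'k\<close> is a ring for \<open>'m\<close> of class \<^class>\<open>monoid_add\<close>.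
\<close>

datatype 'g gen = Grp 'g | Gx | Gy

datatype 'a free_monoid = Word (letters: "'a list")

instantiation free_monoid :: (type) monoid_add
begin
definition zero_free_monoid :: "'a free_monoid" where
  "0 = Word []"
definition plus_free_monoid :: "'a free_monoid \<Rightarrow> 'a free_monoid \<Rightarrow> 'a free_monoid" where
  "u + v = Word (letters u @ letters v)"
instance
  by standard (auto simp: zero_free_monoid_def plus_free_monoid_def)
end

type_synonym ('a, 'k) free_algebra = "'a free_monoid \<Rightarrow>\<^sub>0 'k"

definition free_ring :: "('a, 'k::field) free_algebra ring" where
  "free_ring = \<lparr>carrier = UNIV, monoid.mult = (*), one = 1, ring.zero = 0, ring.add = (+)\<rparr>"

definition scalar :: "'k::field \<Rightarrow> ('a, 'k) free_algebra" where
  "scalar a = Poly_Mapping.single 0 a"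

definition var :: "'a \<Rightarrow> ('a, 'k::field) free_algebra" where
  "var a = Poly_Mapping.single (Word [a]) 1"

text \<open>The linear lift of \<open>g \<mapsto> Grp g\<close> from \<open>K[G]\<close> to the free algebra.\<close>

definition lift_group_algebra :: "('g, 'k::field) group_algebra \<Rightarrow> ('g gen, 'k) free_algebra" where
  "lift_group_algebra u =
     (\<Sum>g\<in>Poly_Mapping.keys u. scalar (Poly_Mapping.lookup u g) * var (Grp g))"

definition H_relators ::
  "('g::ab_group_add \<Rightarrow> 'k::field) \<Rightarrow> 'g \<Rightarrow> 'g \<Rightarrow> ('g gen, 'k) free_algebra set" where
  "H_relators \<chi> b c =
     {var (Grp 0) - 1}
   \<union> {var (Grp g) * var (Grp h) - var (Grp (g + h)) | g h. True}
   \<union> {var Gx * var (Grp g) - scalar (\<chi> g) * var (Grp g) * var Gx | g. True}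
   \<union> {var Gy * var (Grp g) - scalar (inverse (\<chi> g)) * var (Grp g) * var Gy | g. True}
   \<union> {var Gy * var Gx - (var Gx * var Gy + lift_group_algebra (e_elt b c))}"

definition H_ideal ::
  "('g::ab_group_add \<Rightarrow> 'k::field) \<Rightarrow> 'g \<Rightarrow> 'g \<Rightarrow> ('g gen, 'k) free_algebra set" where
  "H_ideal \<chi> b c = Idl\<^bsub>free_ring\<^esub> (H_relators \<chi> b c)"

definition H_algebra ::
  "('g::ab_group_add \<Rightarrow> 'k::field) \<Rightarrow> 'g \<Rightarrow> 'g \<Rightarrow> ('g gen, 'k) free_algebra set ring" where
  "H_algebra \<chi> b c = free_ring Quot H_ideal \<chi> b c"

definition H_class ::
  "('g::ab_group_add \<Rightarrow> 'k::field) \<Rightarrow> 'g \<Rightarrow> 'g \<Rightarrow> ('g gen, 'k) free_algebra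
    \<Rightarrow> ('g gen, 'k) free_algebra set" where
  "H_class \<chi> b c p = H_ideal \<chi> b c +>\<^bsub>free_ring\<^esub> p"


text \<open>
  Left modules over a not necessarily commutative ring: the axioms of the locale \<^locale>\<open>module\<close>, which
  requires a commutative ring.
\<close>

locale left_module = R?: ring R + M?: abelian_group M
    for R :: "('a, 'r) ring_scheme" (structure) and M :: "('a, 'b, 'm) module_scheme" (structure) +
  assumes smult_closed:
      "\<lbrakk>a \<in> carrier R; v \<in> carrier M\<rbrakk> \<Longrightarrow> a \<odot>\<^bsub>M\<^esub> v \<in> carrier M"
    and smult_l_distr:
      "\<lbrakk>a \<in> carrier R; a' \<in> carrier R; v \<in> carrier M\<rbrakk> \<Longrightarrow>
        (a \<oplus>\<^bsub>R\<^esub> a') \<odot>\<^bsub>M\<^esub> v = a \<odot>\<^bsub>M\<^esub> v \<oplus>\<^bsub>M\<^esub> a' \<odot>\<^bsub>M\<^esub> v"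
    and smult_r_distr:
      "\<lbrakk>a \<in> carrier R; v \<in> carrier M; w \<in> carrier M\<rbrakk> \<Longrightarrow>
        a \<odot>\<^bsub>M\<^esub> (v \<oplus>\<^bsub>M\<^esub> w) = a \<odot>\<^bsub>M\<^esub> v \<oplus>\<^bsub>M\<^esub> a \<odot>\<^bsub>M\<^esub> w"
    and smult_assoc:
      "\<lbrakk>a \<in> carrier R; a' \<in> carrier R; v \<in> carrier M\<rbrakk> \<Longrightarrow>
        (a \<otimes>\<^bsub>R\<^esub> a') \<odot>\<^bsub>M\<^esub> v = a \<odot>\<^bsub>M\<^esub> (a' \<odot>\<^bsub>M\<^esub> v)"
    and smult_one:
      "v \<in> carrier M \<Longrightarrow> \<one>\<^bsub>R\<^esub> \<odot>\<^bsub>M\<^esub> v = v"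

definition module_isomorphic ::
  "('r, 's) ring_scheme \<Rightarrow> ('r, 'v) module \<Rightarrow> ('r, 'w) module \<Rightarrow> bool" where
  "module_isomorphic R M N \<longleftrightarrow>
    (\<exists>f. bij_betw f (carrier M) (carrier N) \<and>
      (\<forall>v\<in>carrier M. \<forall>w\<in>carrier M. f (v \<oplus>\<^bsub>M\<^esub> w) = f v \<oplus>\<^bsub>N\<^esub> f w) \<and>
      (\<forall>a\<in>carrier R. \<forall>v\<in>carrier M. f (a \<odot>\<^bsub>M\<^esub> v) = a \<odot>\<^bsub>N\<^esub> f v))"

text \<open>
  The \<open>K\<close>-vector space structure of an \<open>H\<close>-module is the one given by the scalars of \<open>H\<close>.
  \<open>is_basis_of \<chi> b c M n v\<close> says that \<open>v 0, \<dots>, v (n - 1)\<close> is a \<open>K\<close>-basis of \<open>M\<close>.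
\<close>

definition is_basis_of ::
  "('g::ab_group_add \<Rightarrow> 'k::field) \<Rightarrow> 'g \<Rightarrow> 'g \<Rightarrow> (('g gen, 'k) free_algebra set, 'v) module
    \<Rightarrow> nat \<Rightarrow> (nat \<Rightarrow> 'v) \<Rightarrow> bool" where
  "is_basis_of \<chi> b c M n v \<longleftrightarrow>
     (\<forall>i<n. v i \<in> carrier M) \<and>
     (\<forall>w\<in>carrier M. \<exists>!a. (\<forall>i\<ge>n. a i = 0) \<and>
        w = (\<Oplus>\<^bsub>M\<^esub>i\<in>{..<n}. H_class \<chi> b c (scalar (a i)) \<odot>\<^bsub>M\<^esub> v i))"

text \<open>
  \<open>is_Vx n \<chi> b c \<rho> l \<mu> M\<close> says that \<open>M\<close> is the left \<open>H\<close>-module \<open>V\<^sub>x(\<rho>, l, \<mu>)\<close>, that is, the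
  \<open>n\<close>-dimensional module given by the displayed formulas in a basis \<open>v 0, \<dots>, v (n - 1)\<close>.  This is a
  predicate rather than a construction since the formulas are compatible with the relation
  \<open>yx = xy + e\<close> on \<open>v (n - 1)\<close> if and only if \<open>\<rho>([e]\<^sub>n) = 0\<close>.  This holds automatically if
  \<open>\<chi> b \<noteq> 1\<close> (\<open>extend_char_bracket_n_eq_0\<close>), and then the module exists (\<open>is_Vx_exists\<close>).
\<close>

definition is_Vx ::
  "nat \<Rightarrow> ('g::ab_group_add \<Rightarrow> 'k::field) \<Rightarrow> 'g \<Rightarrow> 'g \<Rightarrow> ('g \<Rightarrow> 'k) \<Rightarrow> 'k \<Rightarrow> 'k
    \<Rightarrow> (('g gen, 'k) free_algebra set, 'v) module \<Rightarrow> bool" where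
  "is_Vx n \<chi> b c \<rho> l \<mu> M \<longleftrightarrow>
     left_module (H_algebra \<chi> b c) M \<and>
     (\<exists>v. is_basis_of \<chi> b c M n v \<and>
       (\<forall>i. i + 1 < n \<longrightarrow> H_class \<chi> b c (var Gx) \<odot>\<^bsub>M\<^esub> v i = v (i + 1)) \<and>
       H_class \<chi> b c (var Gx) \<odot>\<^bsub>M\<^esub> v (n - 1) = H_class \<chi> b c (scalar l) \<odot>\<^bsub>M\<^esub> v 0 \<and>
       H_class \<chi> b c (var Gy) \<odot>\<^bsub>M\<^esub> v 0 =
         H_class \<chi> b c (scalar (inverse l * \<mu>)) \<odot>\<^bsub>M\<^esub> v (n - 1) \<and>
       (\<forall>i. 1 \<le> i \<and> i < n \<longrightarrow>
         H_class \<chi> b c (var Gy) \<odot>\<^bsub>M\<^esub> v i =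
           H_class \<chi> b c (scalar (\<mu> + extend_char \<rho> (sigma_bracket \<chi> i (e_elt b c))))
             \<odot>\<^bsub>M\<^esub> v (i - 1)) \<and>
       (\<forall>g. \<forall>i<n.
         H_class \<chi> b c (var (Grp g)) \<odot>\<^bsub>M\<^esub> v i =
           H_class \<chi> b c (scalar
             (extend_char \<rho> ((inv_into UNIV (sigma \<chi>) ^^ i) (Poly_Mapping.single g 1)))) \<odot>\<^bsub>M\<^esub> v i))"


subsection \<open>Existence of \<open>V\<^sub>x(\<rho>, l, \<mu>)\<close>\<close>

lemma group_dual_group: "group (dual_group :: ('g::ab_group_add \<Rightarrow> 'k::field) monoid)"
proof (rule groupI)
  fix \<rho> :: "'g \<Rightarrow> 'k"
  assume r: "\<rho> \<in> carrier dual_group"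
  have "(\<lambda>g. inverse (\<rho> g)) \<in> carrier dual_group"
    using r by (auto simp: dual_group_def)
  moreover have "(\<lambda>g. inverse (\<rho> g)) \<otimes>\<^bsub>dual_group\<^esub> \<rho> = \<one>\<^bsub>dual_group\<^esub>"
    using r by (auto simp: dual_group_def)
  ultimately show "\<exists>\<rho>'\<in>carrier dual_group. \<rho>' \<otimes>\<^bsub>dual_group\<^esub> \<rho> = \<one>\<^bsub>dual_group\<^esub>"
    by blast
qed (auto simp: dual_group_def mult_ac)

lemma ring_free_ring: "ring (free_ring :: ('a, 'k::field) free_algebra ring)"
proof (rule ringI)
  show "abelian_group (free_ring :: ('a, 'k) free_algebra ring)"
  proof (rule abelian_groupI)
    fix x :: "('a, 'k) free_algebra"
    have "- x \<in> carrier free_ring \<and> - x \<oplus>\<^bsub>free_ring\<^esub> x = \<zero>\<^bsub>free_ring\<^esub>"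
      by (simp add: free_ring_def)
    then show "\<exists>y\<in>carrier free_ring. y \<oplus>\<^bsub>free_ring\<^esub> x = \<zero>\<^bsub>free_ring\<^esub>"
      by blast
  qed (auto simp: free_ring_def algebra_simps)
  show "Group.monoid (free_ring :: ('a, 'k) free_algebra ring)"
    by standard (auto simp: free_ring_def algebra_simps)
qed (auto simp: free_ring_def algebra_simps)

lemma ideal_H_ideal: "ideal (H_ideal \<chi> b c) free_ring"
  unfolding H_ideal_def
  by (rule ring.genideal_ideal[OF ring_free_ring]) (simp add: free_ring_def)

lemma lookup_sigma: "Poly_Mapping.lookup (sigma \<chi> u) g = \<chi> g * Poly_Mapping.lookup u g"
  by (auto simp: sigma_def lookup_mapp when_def in_keys_iff)

lemma inv_sigma:
  assumes "\<chi> \<in> carrier dual_group"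
  shows "inv_into UNIV (sigma \<chi>) = sigma (\<lambda>g. inverse (\<chi> g))"
  using assms
  by (intro inv_unique_comp) (auto simp: dual_group_def fun_eq_iff lookup_sigma intro!: poly_mapping_eqI)

lemma sigma_funpow_single:
  "(sigma \<chi> ^^ i) (Poly_Mapping.single g a) = Poly_Mapping.single g (\<chi> g ^ i * a)"
  by (induction i arbitrary: a)
     (auto intro!: poly_mapping_eqI simp: lookup_sigma lookup_single when_def)

lemma sigma_diff: "sigma \<chi> (u - v) = sigma \<chi> u - sigma \<chi> v"
  by (rule poly_mapping_eqI) (simp add: lookup_sigma lookup_minus right_diff_distrib)

lemma sigma_funpow_diff: "(sigma \<chi> ^^ i) (u - v) = (sigma \<chi> ^^ i) u - (sigma \<chi> ^^ i) v"
  by (induction i) (auto simp: sigma_diff)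

lemma extend_char_superset:
  assumes "finite A" "Poly_Mapping.keys u \<subseteq> A"
  shows "extend_char \<rho> u = (\<Sum>g\<in>A. Poly_Mapping.lookup u g * \<rho> g)"
  unfolding extend_char_def
  by (rule sum.mono_neutral_left) (use assms in \<open>auto simp: in_keys_iff\<close>)

lemma extend_char_add: "extend_char \<rho> (u + v) = extend_char \<rho> u + extend_char \<rho> v"
proof -
  define A where "A = Poly_Mapping.keys u \<union> Poly_Mapping.keys v"
  have A: "finite A" "Poly_Mapping.keys u \<subseteq> A" "Poly_Mapping.keys v \<subseteq> A"
    "Poly_Mapping.keys (u + v) \<subseteq> A"
    using keys_add[of u v] by (auto simp: A_def)
  show ?thesis
    using A by (simp add: extend_char_superset[of A] lookup_add algebra_simps sum.distrib)
qed

lemma extend_char_0 [simp]: "extend_char \<rho> 0 = 0"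
  by (simp add: extend_char_def)

lemma extend_char_diff: "extend_char \<rho> (u - v) = extend_char \<rho> u - extend_char \<rho> v"
  using extend_char_add[of \<rho> "u - v" v] by (simp add: algebra_simps)

lemma extend_char_sum: "extend_char \<rho> (\<Sum>i\<in>A. u i) = (\<Sum>i\<in>A. extend_char \<rho> (u i))"
  by (induction A rule: infinite_finite_induct) (auto simp: extend_char_add)

lemma extend_char_single [simp]: "extend_char \<rho> (Poly_Mapping.single g a) = a * \<rho> g"
  by (cases "a = 0") (auto simp: extend_char_def)

lemma poly_mapping_add_single_induct:
  assumes "P 0" "\<And>u g (a :: 'k::field). P u \<Longrightarrow> P (u + Poly_Mapping.single g a)"
  shows "P u"
proof (induction u rule: update_induct)
  case (update f a b)
  have "Poly_Mapping.update a b f = f + Poly_Mapping.single a b"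
    using update(1)
    by (auto intro!: poly_mapping_eqI simp: lookup_update lookup_add lookup_single when_def in_keys_iff)
  then show ?case using assms(2) update by metis
qed (rule assms)

lemma extend_char_bracket_e:
  assumes "\<chi> \<in> carrier dual_group"
  shows "extend_char \<rho> (sigma_bracket \<chi> i (e_elt b c)) =
    (\<Sum>k<i. \<chi> c ^ k * \<rho> (- c) - inverse (\<chi> b) ^ k * \<rho> b)"
proof -
  have "\<chi> (- c) * \<chi> c = 1"
    using assms unfolding dual_group_def
    by simp (metis add.right_neutral add_cancel_right_left left_minus mult_cancel_left2)
  then have "inverse (\<chi> (- c)) = \<chi> c"
    by (simp add: inverse_unique)
  then show ?thesis
    by (simp add: sigma_bracket_def extend_char_sum inv_sigma[OF assms] e_elt_def sigma_funpow_diff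
        sigma_funpow_single extend_char_diff)
qed

lemma dual_group_pow_nat:
  "\<chi> [^]\<^bsub>dual_group\<^esub> (k::nat) = (\<lambda>g. \<chi> g ^ k)"
  by (induction k) (auto simp: dual_group_def fun_eq_iff mult_ac)

lemma dual_group_pow_minus:
  assumes "\<chi> \<in> carrier dual_group"
  shows "\<chi> [^]\<^bsub>dual_group\<^esub> (- int k) = (\<lambda>g. inverse (\<chi> g) ^ k)"
proof -
  interpret group "dual_group :: ('a \<Rightarrow> 'b) monoid" by (rule group_dual_group)
  have "inv\<^bsub>dual_group\<^esub> (\<chi> [^]\<^bsub>dual_group\<^esub> k) = (\<lambda>g. inverse (\<chi> g) ^ k)"
    unfolding dual_group_pow_nat
    by (rule inv_equality)
       (use assms in \<open>auto simp: dual_group_def fun_eq_iff power_mult_distrib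
          simp flip: power_mult_distrib\<close>)
  then show ?thesis
    using assms by (simp add: int_pow_neg int_pow_int)
qed

lemma extend_char_bracket_n_eq_0:
  fixes \<chi> :: "'g::ab_group_add \<Rightarrow> 'k::field"
  assumes "\<chi> \<in> carrier dual_group" "n = group.ord dual_group \<chi>"
    and "\<chi> b = \<chi> c" "\<chi> b \<noteq> 1"
  shows "extend_char \<rho> (sigma_bracket \<chi> n (e_elt b c)) = 0"
proof -
  interpret group "dual_group :: ('g \<Rightarrow> 'k) monoid" by (rule group_dual_group)
  have "(\<lambda>g. \<chi> g ^ n) = (\<lambda>_. 1)"
    using pow_ord_eq_1[OF assms(1)] unfolding assms(2)[symmetric] dual_group_pow_nat
    by (simp add: dual_group_def)
  then have *: "\<chi> b ^ n = 1" by metis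
  have "(\<Sum>k<n. x ^ k) = 0" if "x ^ n = 1" "x \<noteq> 1" for x :: 'k
    using geometric_sum[OF that(2), of n] that(1) by simp
  from this[of "\<chi> b"] this[of "inverse (\<chi> b)"]
  have "(\<Sum>k<n. \<chi> b ^ k) = 0" "(\<Sum>k<n. inverse (\<chi> b) ^ k) = 0"
    using assms(4) * by (auto simp: power_inverse)
  then show ?thesis
    by (simp add: extend_char_bracket_e[OF assms(1)] sum_subtractf assms(3)
        flip: sum_distrib_right)
qed

definition Vx_gen ::
  "nat \<Rightarrow> ('g::ab_group_add \<Rightarrow> 'k::field) \<Rightarrow> 'g \<Rightarrow> 'g \<Rightarrow> ('g \<Rightarrow> 'k) \<Rightarrow> 'k \<Rightarrow> 'k
    \<Rightarrow> 'g gen \<Rightarrow> (nat \<Rightarrow> 'k) \<Rightarrow> nat \<Rightarrow> 'k" where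
  "Vx_gen n \<chi> b c \<rho> l \<mu> a f i =
     (if i \<ge> n then 0 else
      (case a of
         Grp g \<Rightarrow> \<rho> g * inverse (\<chi> g) ^ i * f i
       | Gx \<Rightarrow> (if i = 0 then l * f (n - 1) else f (i - 1))
       | Gy \<Rightarrow> (if i = n - 1 then inverse l * \<mu> * f 0
                else (\<mu> + extend_char \<rho> (sigma_bracket \<chi> (i + 1) (e_elt b c))) * f (i + 1))))"

text \<open>\<open>Vx_act\<close> is the extension of an action \<open>G\<close> of the generators to the free algebra.\<close>

definition Vx_act ::
  "('a \<Rightarrow> (nat \<Rightarrow> 'k::field) \<Rightarrow> nat \<Rightarrow> 'k) \<Rightarrow> ('a, 'k) free_algebra \<Rightarrow> (nat \<Rightarrow> 'k) \<Rightarrow> nat \<Rightarrow> 'k" where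
  "Vx_act G p f i = extend_char (\<lambda>w. foldr G (letters w) f i) p"

definition Vx_module ::
  "nat \<Rightarrow> ('g::ab_group_add \<Rightarrow> 'k::field) \<Rightarrow> 'g \<Rightarrow> 'g \<Rightarrow> ('g \<Rightarrow> 'k) \<Rightarrow> 'k \<Rightarrow> 'k
    \<Rightarrow> (('g gen, 'k) free_algebra set, nat \<Rightarrow> 'k) module" where
  "Vx_module n \<chi> b c \<rho> l \<mu> =
     \<lparr>carrier = {f. \<forall>i\<ge>n. f i = 0}, monoid.mult = (\<lambda>f g. f), one = (\<lambda>_. 0),
      ring.zero = (\<lambda>_. 0), ring.add = (\<lambda>f g i. f i + g i),
      module.smult = (\<lambda>h. Vx_act (Vx_gen n \<chi> b c \<rho> l \<mu>) (SOME p. p \<in> h))\<rparr>"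

lemma Vx_gen_add:
  "Vx_gen n \<chi> b c \<rho> l \<mu> a (\<lambda>i. f i + g i) =
     (\<lambda>i. Vx_gen n \<chi> b c \<rho> l \<mu> a f i + Vx_gen n \<chi> b c \<rho> l \<mu> a g i)"
  by (auto simp: Vx_gen_def fun_eq_iff algebra_simps split: gen.splits)

lemma Vx_gen_scale:
  "Vx_gen n \<chi> b c \<rho> l \<mu> a (\<lambda>i. d * f i) = (\<lambda>i. d * Vx_gen n \<chi> b c \<rho> l \<mu> a f i)"
  by (auto simp: Vx_gen_def fun_eq_iff algebra_simps split: gen.splits)

lemma Vx_act_add_left: "Vx_act G (p + q) f = (\<lambda>i. Vx_act G p f i + Vx_act G q f i)"
  by (simp add: Vx_act_def fun_eq_iff extend_char_add)

lemma Vx_act_diff_left: "Vx_act G (p - q) f = (\<lambda>i. Vx_act G p f i - Vx_act G q f i)"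
  by (simp add: Vx_act_def fun_eq_iff extend_char_diff)

lemma Vx_act_sum_left: "Vx_act G (\<Sum>j\<in>A. p j) f = (\<lambda>i. \<Sum>j\<in>A. Vx_act G (p j) f i)"
  by (simp add: Vx_act_def fun_eq_iff extend_char_sum)

lemma Vx_act_single: "Vx_act G (Poly_Mapping.single w a) f = (\<lambda>i. a * foldr G (letters w) f i)"
  by (simp add: Vx_act_def fun_eq_iff)

lemma Vx_act_scalar: "Vx_act G (scalar a) f = (\<lambda>i. a * f i)"
  by (simp add: scalar_def Vx_act_single zero_free_monoid_def)

lemma Vx_act_0: "Vx_act G 0 f = (\<lambda>_. 0)"
  by (simp add: Vx_act_def fun_eq_iff)

lemma Vx_act_1: "Vx_act G 1 f = f"
  using Vx_act_scalar[of G 1 f] by (simp add: scalar_def)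

lemma Vx_act_var: "Vx_act G (var a) f = G a f"
  by (simp add: var_def Vx_act_single)

context
  fixes n :: nat and \<chi> :: "'g::ab_group_add \<Rightarrow> 'k::field" and b c :: 'g
    and \<rho> :: "'g \<Rightarrow> 'k" and l \<mu> :: 'k and G and M
  defines "G \<equiv> Vx_gen n \<chi> b c \<rho> l \<mu>" and "M \<equiv> Vx_module n \<chi> b c \<rho> l \<mu>"
begin

lemma foldr_G_add: "foldr G w (\<lambda>i. f i + g i) = (\<lambda>i. foldr G w f i + foldr G w g i)"
  by (induction w) (auto simp: G_def Vx_gen_add)

lemma foldr_G_scale: "foldr G w (\<lambda>i. d * f i) = (\<lambda>i. d * foldr G w f i)"
  by (induction w) (auto simp: G_def Vx_gen_scale)

lemma Vx_act_add_right: "Vx_act G p (\<lambda>i. f i + g i) = (\<lambda>i. Vx_act G p f i + Vx_act G p g i)"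
  by (induction p rule: poly_mapping_add_single_induct)
     (auto simp: Vx_act_0 Vx_act_add_left Vx_act_single foldr_G_add algebra_simps fun_eq_iff)

lemma Vx_act_scale_right: "Vx_act G p (\<lambda>i. d * f i) = (\<lambda>i. d * Vx_act G p f i)"
  by (induction p rule: poly_mapping_add_single_induct)
     (auto simp: Vx_act_0 Vx_act_add_left Vx_act_single foldr_G_scale algebra_simps fun_eq_iff)

lemma Vx_act_zero_right: "Vx_act G p (\<lambda>_. 0) = (\<lambda>_. 0)"
  using Vx_act_scale_right[of p 0 "\<lambda>_. 0"] by simp

lemma Vx_act_mult: "Vx_act G (p * q) f = Vx_act G p (Vx_act G q f)"
proof (induction p rule: poly_mapping_add_single_induct)
  case (2 p u a)
  have "Vx_act G (Poly_Mapping.single u a * q) f = Vx_act G (Poly_Mapping.single u a) (Vx_act G q f)"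
  proof (induction q rule: poly_mapping_add_single_induct)
    case (2 q v d)
    then show ?case
      by (simp add: distrib_left Vx_act_add_left Vx_act_add_right mult_single Vx_act_single
          plus_free_monoid_def foldr_G_scale foldr_G_add algebra_simps)
  qed (simp add: Vx_act_0 Vx_act_zero_right)
  with 2 show ?case
    by (simp add: distrib_right Vx_act_add_left)
qed (simp add: Vx_act_0)

lemma Vx_act_closed:
  assumes "f \<in> carrier M"
  shows "Vx_act G p f \<in> carrier M"
proof -
  have w: "foldr G w f i = 0" if "i \<ge> n" for i w
    using assms that by (cases w) (auto simp: M_def Vx_module_def G_def Vx_gen_def)
  show ?thesis
    using w by (simp add: M_def Vx_module_def Vx_act_def extend_char_def)
qed

context
  assumes chi: "\<chi> \<in> carrier dual_group" and rho: "\<rho> \<in> carrier dual_group"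
    and n: "n = group.ord dual_group \<chi>" "0 < n" and l: "l \<noteq> 0"
    and B0: "extend_char \<rho> (sigma_bracket \<chi> n (e_elt b c)) = 0"
begin

lemma chi_pow_n: "\<chi> g ^ n = 1"
proof -
  interpret group "dual_group :: ('g \<Rightarrow> 'k) monoid" by (rule group_dual_group)
  have "(\<lambda>g. \<chi> g ^ n) = (\<lambda>_. 1)"
    using pow_ord_eq_1[OF chi] unfolding n(1)[symmetric] dual_group_pow_nat
    by (simp add: dual_group_def)
  then show ?thesis by metis
qed

lemma char_nz: "\<chi> g \<noteq> 0" "\<rho> g \<noteq> 0"
  using chi rho by (auto simp: dual_group_def)

lemma char_add: "\<chi> (g + h) = \<chi> g * \<chi> h" "\<rho> (g + h) = \<rho> g * \<rho> h"
  using chi rho by (auto simp: dual_group_def)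

lemma char_0: "\<chi> 0 = 1" "\<rho> 0 = 1"
  using char_add[of 0 0] char_nz[of 0] by auto

lemma char_minus: "\<chi> (- g) = inverse (\<chi> g)"
  using char_add(1)[of g "- g"] char_0 by (simp add: inverse_unique)

lemma Vx_act_relator:
  assumes p: "p \<in> H_relators \<chi> b c" and f: "f \<in> carrier M"
  shows "Vx_act G p f = (\<lambda>_. 0)"
proof -
  define B where "B i = extend_char \<rho> (sigma_bracket \<chi> i (e_elt b c))" for i
  have B_0: "B 0 = 0" and B_n: "B n = 0"
    using B0 by (simp_all add: B_def sigma_bracket_def)
  have B_Suc: "B (Suc i) = B i + (\<chi> c ^ i * \<rho> (- c) - inverse (\<chi> b) ^ i * \<rho> b)" for i
    by (simp add: B_def extend_char_bracket_e[OF chi])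
  have f0: "f i = 0" if "i \<ge> n" for i
    using f that by (simp add: M_def Vx_module_def)
  have pow1: "\<chi> g * inverse (\<chi> g) ^ i = inverse (\<chi> g) ^ (i - 1)" if "i > 0" for g i
    using that char_nz[of g] by (cases i) auto
  have pown: "inverse (\<chi> g) ^ (n - 1) = \<chi> g" for g
    using pow1[of n g] n(2) chi_pow_n[of g] by (simp add: power_inverse)
  have lift: "Vx_act G (lift_group_algebra u) f i =
      (if i \<ge> n then 0 else extend_char (\<lambda>g. \<rho> g * inverse (\<chi> g) ^ i) u * f i)" for u i
  proof -
    have "Vx_act G (lift_group_algebra u) f i =
        (\<Sum>g\<in>Poly_Mapping.keys u. Poly_Mapping.lookup u g * G (Grp g) f i)"
      by (simp add: lift_group_algebra_def Vx_act_sum_left Vx_act_mult Vx_act_scalar Vx_act_var)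
    then show ?thesis
      by (simp add: G_def Vx_gen_def extend_char_def sum_distrib_right sum_distrib_left mult_ac)
  qed
  note act = Vx_act_diff_left Vx_act_add_left Vx_act_mult Vx_act_var Vx_act_scalar Vx_act_1
  consider "p = var (Grp 0) - 1"
    | g h where "p = var (Grp g) * var (Grp h) - var (Grp (g + h))"
    | g where "p = var Gx * var (Grp g) - scalar (\<chi> g) * var (Grp g) * var Gx"
    | g where "p = var Gy * var (Grp g) - scalar (inverse (\<chi> g)) * var (Grp g) * var Gy"
    | "p = var Gy * var Gx - (var Gx * var Gy + lift_group_algebra (e_elt b c))"
    using p by (auto simp: H_relators_def)
  then show ?thesis
  proof cases
    case 1
    then show ?thesis
      by (auto simp: act G_def Vx_gen_def fun_eq_iff f0 char_0)
  next
    case (2 g h)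
    have "G (Grp g) (G (Grp h) f) = G (Grp (g + h)) f"
      by (auto simp: G_def Vx_gen_def fun_eq_iff char_add power_mult_distrib mult_ac)
    then show ?thesis
      using 2 by (simp add: act)
  next
    case (3 g)
    have "G Gx (G (Grp g) f) i = \<chi> g * G (Grp g) (G Gx f) i" for i
      using n(2) pow1[of i g] pown[of g] by (auto simp: G_def Vx_gen_def simp del: power_inverse)
    then show ?thesis
      using 3 by (simp add: act fun_eq_iff mult_ac)
  next
    case (4 g)
    have "G Gy (G (Grp g) f) i = inverse (\<chi> g) * G (Grp g) (G Gy f) i" for i
    proof (cases "i = n - 1")
      case True
      then show ?thesis
        using n(2) char_nz[of g] pown[of g]
        by (simp add: G_def Vx_gen_def)
    next
      case False
      then show ?thesis
        using n(2) by (auto simp: G_def Vx_gen_def)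
    qed
    then show ?thesis
      using 4 by (simp add: act fun_eq_iff mult_ac)
  next
    case 5
    have "G Gy (G Gx f) i = G Gx (G Gy f) i +
        (if i \<ge> n then 0 else (B (Suc i) - B i) * f i)" for i
    proof (cases "i < n")
      case True
      have "G Gy (G Gx f) i = (\<mu> + B (Suc i)) * f i"
        using True n(2) l B_n by (auto simp: G_def Vx_gen_def B_def)
      moreover have "G Gx (G Gy f) i = (\<mu> + B i) * f i"
        using True n(2) l B_0 by (auto simp: G_def Vx_gen_def B_def)
      ultimately show ?thesis using True by (simp add: algebra_simps)
    qed (simp add: G_def Vx_gen_def)
    moreover have "extend_char (\<lambda>g. \<rho> g * inverse (\<chi> g) ^ i) (e_elt b c) = B (Suc i) - B i" for i
      using char_minus[of c] by (simp add: e_elt_def extend_char_diff B_Suc mult_ac)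
    ultimately show ?thesis
      using 5 by (auto simp: act lift fun_eq_iff)
  qed
qed

lemma Vx_act_ideal:
  assumes "p \<in> H_ideal \<chi> b c" "f \<in> carrier M"
  shows "Vx_act G p f = (\<lambda>_. 0)"
proof -
  define J where "J = {p. \<forall>f\<in>carrier M. Vx_act G p f = (\<lambda>_. 0)}"
  interpret R: ring "free_ring :: ('g gen, 'k) free_algebra ring" by (rule ring_free_ring)
  have minus: "\<ominus>\<^bsub>free_ring\<^esub> p = - p" for p :: "('g gen, 'k) free_algebra"
    by (rule R.minus_equality) (simp_all add: free_ring_def)
  have "ideal J free_ring"
  proof (rule idealI[OF ring_free_ring])
    show "subgroup J (add_monoid free_ring)"
    proof (rule R.add.subgroupI)
      fix p assume "p \<in> J"
      then show "\<ominus>\<^bsub>free_ring\<^esub> p \<in> J"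
        using Vx_act_diff_left[of G 0 p] by (simp add: minus J_def Vx_act_0)
    qed (auto simp: J_def free_ring_def Vx_act_add_left intro: exI[of _ 0] Vx_act_0)
  qed (use Vx_act_closed in \<open>auto simp: J_def free_ring_def Vx_act_mult Vx_act_zero_right\<close>)
  then have "H_ideal \<chi> b c \<subseteq> J"
    unfolding H_ideal_def
    by (rule R.genideal_minimal) (auto simp: J_def Vx_act_relator)
  then show ?thesis
    using assms by (auto simp: J_def)
qed

lemma Vx_smult_class:
  assumes f: "f \<in> carrier M"
  shows "H_class \<chi> b c p \<odot>\<^bsub>M\<^esub> f = Vx_act G p f"
proof -
  interpret I: ideal "H_ideal \<chi> b c" "free_ring :: ('g gen, 'k) free_algebra ring"
    by (rule ideal_H_ideal)
  define q where "q = (SOME q. q \<in> H_class \<chi> b c p)"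
  have "p \<in> H_class \<chi> b c p"
    unfolding H_class_def by (rule I.a_rcos_self) (simp add: free_ring_def)
  then have "q \<in> H_class \<chi> b c p"
    unfolding q_def by (rule someI)
  then obtain j where "j \<in> H_ideal \<chi> b c" "q = j + p"
    by (auto simp: H_class_def a_r_coset_def r_coset_def free_ring_def)
  then have "Vx_act G q f = Vx_act G p f"
    using f by (simp add: Vx_act_add_left Vx_act_ideal)
  moreover have "H_class \<chi> b c p \<odot>\<^bsub>M\<^esub> f = Vx_act G q f"
    by (simp add: M_def Vx_module_def G_def q_def)
  ultimately show ?thesis by simp
qed

lemma is_Vx_Vx_module: "is_Vx n \<chi> b c \<rho> l \<mu> M"
proof -
  interpret I: ideal "H_ideal \<chi> b c" "free_ring :: ('g gen, 'k) free_algebra ring"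
    by (rule ideal_H_ideal)
  have H: "H_class \<chi> b c \<in> ring_hom free_ring (H_algebra \<chi> b c)"
    unfolding H_class_def[abs_def] H_algebra_def by (rule I.rcos_ring_hom)
  have H_add: "H_class \<chi> b c p \<oplus>\<^bsub>H_algebra \<chi> b c\<^esub> H_class \<chi> b c q = H_class \<chi> b c (p + q)" for p q
    using ring_hom_add[OF H, of p q] by (simp add: free_ring_def)
  have H_mult: "H_class \<chi> b c p \<otimes>\<^bsub>H_algebra \<chi> b c\<^esub> H_class \<chi> b c q = H_class \<chi> b c (p * q)" for p q
    using ring_hom_mult[OF H, of p q] by (simp add: free_ring_def)
  have H_one: "\<one>\<^bsub>H_algebra \<chi> b c\<^esub> = H_class \<chi> b c 1"
    using ring_hom_one[OF H] by (simp add: free_ring_def)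
  have H_carrier: "\<exists>p. h = H_class \<chi> b c p" if "h \<in> carrier (H_algebra \<chi> b c)" for h
    using that by (auto simp: H_algebra_def FactRing_def A_RCOSETS_def' H_class_def)
  have M_carrier: "f \<in> carrier M \<longleftrightarrow> (\<forall>i\<ge>n. f i = 0)" for f
    by (simp add: M_def Vx_module_def)
  have M_add: "f \<oplus>\<^bsub>M\<^esub> g = (\<lambda>i. f i + g i)" for f g
    by (simp add: M_def Vx_module_def)
  have M_zero: "\<zero>\<^bsub>M\<^esub> = (\<lambda>i. 0)"
    by (simp add: M_def Vx_module_def)
  interpret M: abelian_group M
  proof (rule abelian_groupI)
    fix f assume "f \<in> carrier M"
    then have "(\<lambda>i. - f i) \<in> carrier M \<and> (\<lambda>i. - f i) \<oplus>\<^bsub>M\<^esub> f = \<zero>\<^bsub>M\<^esub>"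
      by (auto simp: M_carrier M_add M_zero)
    then show "\<exists>g\<in>carrier M. g \<oplus>\<^bsub>M\<^esub> f = \<zero>\<^bsub>M\<^esub>" by blast
  qed (auto simp: M_carrier M_add M_zero algebra_simps)
  have "left_module (H_algebra \<chi> b c) M"
  proof (intro left_module.intro left_module_axioms.intro)
    show "ring (H_algebra \<chi> b c)"
      unfolding H_algebra_def by (rule I.quotient_is_ring)
    show "abelian_group M" ..
  next
    fix h f assume "h \<in> carrier (H_algebra \<chi> b c)" "f \<in> carrier M"
    then show "h \<odot>\<^bsub>M\<^esub> f \<in> carrier M"
      using H_carrier[of h] by (auto simp: Vx_smult_class Vx_act_closed)
  next
    fix h k f
    assume *: "h \<in> carrier (H_algebra \<chi> b c)" "k \<in> carrier (H_algebra \<chi> b c)" "f \<in> carrier M"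
    then obtain p q where pq: "h = H_class \<chi> b c p" "k = H_class \<chi> b c q"
      using H_carrier by blast
    show "(h \<oplus>\<^bsub>H_algebra \<chi> b c\<^esub> k) \<odot>\<^bsub>M\<^esub> f = h \<odot>\<^bsub>M\<^esub> f \<oplus>\<^bsub>M\<^esub> k \<odot>\<^bsub>M\<^esub> f"
      using *(3) by (simp add: pq H_add Vx_smult_class M_add Vx_act_add_left)
    show "(h \<otimes>\<^bsub>H_algebra \<chi> b c\<^esub> k) \<odot>\<^bsub>M\<^esub> f = h \<odot>\<^bsub>M\<^esub> (k \<odot>\<^bsub>M\<^esub> f)"
      using *(3) by (simp add: pq H_mult Vx_smult_class Vx_act_closed Vx_act_mult)
  next
    fix h f g
    assume *: "h \<in> carrier (H_algebra \<chi> b c)" "f \<in> carrier M" "g \<in> carrier M"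
    then obtain p where p: "h = H_class \<chi> b c p"
      using H_carrier by blast
    show "h \<odot>\<^bsub>M\<^esub> (f \<oplus>\<^bsub>M\<^esub> g) = h \<odot>\<^bsub>M\<^esub> f \<oplus>\<^bsub>M\<^esub> h \<odot>\<^bsub>M\<^esub> g"
      using * M.a_closed[OF *(2,3)] by (simp add: p Vx_smult_class M_add Vx_act_add_right)
  next
    fix f assume "f \<in> carrier M"
    then show "\<one>\<^bsub>H_algebra \<chi> b c\<^esub> \<odot>\<^bsub>M\<^esub> f = f"
      by (simp add: H_one Vx_smult_class Vx_act_1)
  qed
  moreover
  define v where "v j = (\<lambda>i. if i = j then 1 else 0 :: 'k)" for j :: nat
  have v: "v j \<in> carrier M" if "j < n" for j
    using that by (auto simp: v_def M_carrier)
  have sumv: "finite A \<Longrightarrow> A \<subseteq> {..<n} \<Longrightarrow>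
      (\<Oplus>\<^bsub>M\<^esub>j\<in>A. H_class \<chi> b c (scalar (a j)) \<odot>\<^bsub>M\<^esub> v j) = (\<lambda>i. if i \<in> A then a i else 0)"
    for A and a :: "nat \<Rightarrow> 'k"
  proof (induction A rule: finite_induct)
    case (insert j A)
    have cl: "H_class \<chi> b c (scalar (a j)) \<odot>\<^bsub>M\<^esub> v j \<in> carrier M" if "j < n" for j
      using v[OF that] by (simp add: Vx_smult_class Vx_act_closed)
    have "(\<Oplus>\<^bsub>M\<^esub>j\<in>insert j A. H_class \<chi> b c (scalar (a j)) \<odot>\<^bsub>M\<^esub> v j) =
        (H_class \<chi> b c (scalar (a j)) \<odot>\<^bsub>M\<^esub> v j) \<oplus>\<^bsub>M\<^esub>
        (\<Oplus>\<^bsub>M\<^esub>j\<in>A. H_class \<chi> b c (scalar (a j)) \<odot>\<^bsub>M\<^esub> v j)"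
      using insert by (intro M.finsum_insert) (auto intro: cl)
    also have "\<dots> = (\<lambda>i. if i \<in> insert j A then a i else 0)"
      using insert v[of j]
      by (auto simp: M_add fun_eq_iff Vx_smult_class Vx_act_scalar) (auto simp: v_def split: if_splits)
    finally show ?case .
  qed (simp add: M_zero)
  have "is_basis_of \<chi> b c M n v"
    unfolding is_basis_of_def
  proof (intro conjI ballI allI impI)
    fix w assume "w \<in> carrier M"
    then have w: "\<forall>i\<ge>n. w i = 0" by (simp add: M_carrier)
    show "\<exists>!a. (\<forall>i\<ge>n. a i = 0) \<and> w = (\<Oplus>\<^bsub>M\<^esub>i\<in>{..<n}. H_class \<chi> b c (scalar (a i)) \<odot>\<^bsub>M\<^esub> v i)"
      by (rule ex1I[of _ w]) (use w in \<open>auto simp: sumv fun_eq_iff not_less\<close>)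
  qed (rule v)
  moreover have "extend_char \<rho> ((inv_into UNIV (sigma \<chi>) ^^ i) (Poly_Mapping.single g 1)) =
      \<rho> g * inverse (\<chi> g) ^ i" for g i
    by (simp add: inv_sigma[OF chi] sigma_funpow_single mult_ac)
  ultimately show ?thesis
    unfolding is_Vx_def using n(2) l v
    by (intro conjI exI[of _ v] allI impI)
       (auto simp: Vx_smult_class Vx_act_var Vx_act_scalar G_def Vx_gen_def v_def fun_eq_iff)
qed

end

end

lemma is_Vx_exists:
  fixes \<chi> \<rho> :: "'g::ab_group_add \<Rightarrow> 'k::field"
  assumes "\<chi> \<in> carrier dual_group" "\<rho> \<in> carrier dual_group" "n = group.ord dual_group \<chi>" "0 < n"
    and "l \<noteq> 0" and "extend_char \<rho> (sigma_bracket \<chi> n (e_elt b c)) = 0"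
  shows "\<exists>M :: (('g gen, 'k) free_algebra set, nat \<Rightarrow> 'k) module. is_Vx n \<chi> b c \<rho> l \<mu> M"
  using is_Vx_Vx_module[OF assms] by blast

end

theory Submission
  imports Defs
begin

text \<open>
  Coordinates in the basis \<open>v\<^sub>0, \<dots>, v\<^sub>n\<^sub>-\<^sub>1\<close> identify every module \<open>V\<^sub>x(\<rho>, l, \<mu>)\<close> with the same concrete
  model, \<^const>\<open>Vx_module\<close>, in which the generators act on functions \<open>nat \<Rightarrow> 'k\<close> supported below \<open>n\<close>
  (\<open>Vx_module_isomorphic_is_Vx\<close>).  It therefore suffices to compare two models.  The relation
  \<open>yx = xy + e\<close>, applied to \<open>v\<^sub>n\<^sub>-\<^sub>1\<close>, forces \<open>\<rho>([e]\<^sub>n) = 0\<close> as soon as one such module exists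
  (\<open>is_Vx_bracket_n_eq_0\<close>).  This makes the models genuine modules also when \<open>\<chi> b = 1\<close>.

  The parameters are eigenvalues.  On \<open>v\<^sub>k\<close> the group acts by \<open>\<rho> \<chi>\<^sup>-\<^sup>k\<close>, the element \<open>xy\<close> by
  \<open>\<mu> + \<rho>([e]\<^sub>k)\<close> and \<open>x\<^sup>n\<close> by \<open>l\<close>.  An isomorphism sends the vector \<open>v\<^sub>0\<close> of the first module to a
  nonzero common eigenvector \<open>w\<close> with eigenvalues \<open>\<rho>1\<close>, \<open>\<mu>1\<close>, \<open>l1\<close>.  All three operators
  are diagonal in the basis of the second module, so their eigenvalues on \<open>w\<close> can be read off at any
  nonzero coordinate \<open>k\<close> of \<open>w\<close>; this gives the three equations (\<open>Vx_module_isomorphic_imp\<close>).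

  Conversely, \<open>x\<close> is invertible on \<open>V\<^sub>x(\<rho>, l, \<mu>)\<close> because \<open>l \<noteq> 0\<close>, and it commutes with the
  generators up to a change of parameters: multiplication by \<open>x\<close> is an isomorphism
  \<open>V\<^sub>x(\<rho> \<chi>\<^sup>-\<^sup>1, l, \<mu> + \<rho>(e)) \<rightarrow> V\<^sub>x(\<rho>, l, \<mu>)\<close> (\<open>Vx_module_isomorphic_twist\<close>).  The general case follows
  by iterating it \<open>k\<close> times, since \<open>\<rho>([u]\<^sub>k\<^sub>+\<^sub>i) = \<rho>([u]\<^sub>k) + (\<rho> \<chi>\<^sup>-\<^sup>k)([u]\<^sub>i)\<close> (\<open>extend_char_bracket_add\<close>).
\<close>

section \<open>Characters evaluated on brackets\<close>

lemma extend_char_inv_sigma_funpow: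
  assumes "\<chi> \<in> carrier dual_group"
  shows "extend_char \<rho> ((inv_into UNIV (sigma \<chi>) ^^ i) u) =
    extend_char (\<lambda>g. \<rho> g * inverse (\<chi> g) ^ i) u"
proof -
  have lookup: "Poly_Mapping.lookup ((sigma \<psi> ^^ i) u) g = \<psi> g ^ i * Poly_Mapping.lookup u g"
    for \<psi> :: "'a \<Rightarrow> 'b" and g
    by (induction i) (auto simp: lookup_sigma mult_ac)
  have "Poly_Mapping.keys ((sigma (\<lambda>g. inverse (\<chi> g)) ^^ i) u) \<subseteq> Poly_Mapping.keys u"
    by (auto simp: in_keys_iff lookup)
  then show ?thesis
    by (simp add: inv_sigma[OF assms] extend_char_superset[of "Poly_Mapping.keys u"] lookup mult_ac)
qed

lemma extend_char_bracket_Suc: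
  assumes "\<chi> \<in> carrier dual_group"
  shows "extend_char \<rho> (sigma_bracket \<chi> (Suc i) u) =
    extend_char \<rho> (sigma_bracket \<chi> i u) + extend_char (\<lambda>g. \<rho> g * inverse (\<chi> g) ^ i) u"
  by (simp add: sigma_bracket_def extend_char_add extend_char_inv_sigma_funpow[OF assms])

text \<open>
  The cocycle rule for brackets: the parameters of a \<open>k\<close>-fold and an \<open>i\<close>-fold shift by \<open>x\<close> combine to
  those of a \<open>(k + i)\<close>-fold shift.
\<close>

lemma extend_char_bracket_add:
  assumes "\<chi> \<in> carrier dual_group"
  shows "extend_char \<rho> (sigma_bracket \<chi> (k + i) u) = extend_char \<rho> (sigma_bracket \<chi> k u) +
    extend_char (\<lambda>g. \<rho> g * inverse (\<chi> g) ^ k) (sigma_bracket \<chi> i u)"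
  by (induction i)
     (simp_all add: extend_char_bracket_Suc[OF assms] power_add mult_ac, simp add: sigma_bracket_def)

lemma dual_group_pow_ord:
  assumes "\<chi> \<in> carrier dual_group"
  shows "\<chi> g ^ group.ord dual_group \<chi> = 1"
proof -
  have "(\<lambda>g. \<chi> g ^ group.ord dual_group \<chi>) = (\<lambda>_. 1)"
    using group.pow_ord_eq_1[OF group_dual_group assms]
    by (simp add: dual_group_pow_nat) (simp add: dual_group_def)
  then show ?thesis by metis
qed

text \<open>
  A bracket of length \<open>n\<close> sums over a full period of \<open>\<sigma>\<^sup>-\<^sup>1\<close>, so it does not see where the summation
  starts.  Hence the condition \<open>\<rho>([e]\<^sub>n) = 0\<close> is inherited by all twists of \<open>\<rho>\<close>.
\<close>

lemma extend_char_bracket_n_shift: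
  assumes chi: "\<chi> \<in> carrier dual_group" and n: "n = group.ord dual_group \<chi>"
  shows "extend_char (\<lambda>g. \<rho> g * inverse (\<chi> g) ^ k) (sigma_bracket \<chi> n u) =
    extend_char \<rho> (sigma_bracket \<chi> n u)"
  using extend_char_bracket_add[OF chi, of \<rho> k n u] extend_char_bracket_add[OF chi, of \<rho> n k u]
    dual_group_pow_ord[OF chi]
  by (simp add: n add.commute[of _ k] power_inverse)

lemma dual_group_twist_closed:
  assumes "\<chi> \<in> carrier dual_group" "\<rho> \<in> carrier dual_group"
  shows "(\<lambda>g. \<rho> g * inverse (\<chi> g) ^ k) \<in> carrier dual_group"
  using assms by (auto simp: dual_group_def power_mult_distrib)

section \<open>Modules over the algebra H\<close>

lemma H_class_ring_hom: "H_class \<chi> b c \<in> ring_hom free_ring (H_algebra \<chi> b c)"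
  unfolding H_class_def[abs_def] H_algebra_def by (rule ideal.rcos_ring_hom[OF ideal_H_ideal])

lemma H_class_closed: "H_class \<chi> b c p \<in> carrier (H_algebra \<chi> b c)"
  using ring_hom_closed[OF H_class_ring_hom, of p] by (simp add: free_ring_def)

lemma H_class_add:
  "H_class \<chi> b c (p + q) = H_class \<chi> b c p \<oplus>\<^bsub>H_algebra \<chi> b c\<^esub> H_class \<chi> b c q"
  using ring_hom_add[OF H_class_ring_hom, of p q] by (simp add: free_ring_def)

lemma H_class_mult:
  "H_class \<chi> b c (p * q) = H_class \<chi> b c p \<otimes>\<^bsub>H_algebra \<chi> b c\<^esub> H_class \<chi> b c q"
  using ring_hom_mult[OF H_class_ring_hom, of p q] by (simp add: free_ring_def)

lemma H_class_1: "H_class \<chi> b c 1 = \<one>\<^bsub>H_algebra \<chi> b c\<^esub>"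
  using ring_hom_one[OF H_class_ring_hom] by (simp add: free_ring_def)

lemma H_class_relator:
  assumes "p \<in> H_relators \<chi> b c"
  shows "H_class \<chi> b c p = H_class \<chi> b c 0"
proof -
  interpret I: ideal "H_ideal \<chi> b c" "free_ring :: ('a gen, 'b) free_algebra ring"
    by (rule ideal_H_ideal)
  have "p \<in> H_ideal \<chi> b c"
    unfolding H_ideal_def using assms ring.genideal_self[OF ring_free_ring, of "H_relators \<chi> b c"]
    by (auto simp: free_ring_def)
  moreover have "0 \<in> H_ideal \<chi> b c"
    using additive_subgroup.zero_closed[OF I.is_additive_subgroup] by (simp add: free_ring_def)
  ultimately show ?thesis
    unfolding H_class_def by (simp add: I.a_rcos_const)
qed

text \<open>
  The action in \<^const>\<open>Vx_module\<close> evaluates a chosen representative of a class; any representative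
  gives back the class.
\<close>

lemma H_class_some:
  assumes "h \<in> carrier (H_algebra \<chi> b c)"
  shows "H_class \<chi> b c (SOME p. p \<in> h) = h"
proof -
  interpret I: ideal "H_ideal \<chi> b c" "free_ring :: ('a gen, 'b) free_algebra ring"
    by (rule ideal_H_ideal)
  obtain p where p: "h = H_class \<chi> b c p"
    using assms by (auto simp: H_algebra_def FactRing_def A_RCOSETS_def' H_class_def)
  have "p \<in> h"
    unfolding p H_class_def by (rule I.a_rcos_self) (simp add: free_ring_def)
  then have "(SOME p. p \<in> h) \<in> h" by (rule someI)
  then have "(SOME p. p \<in> h) \<in> H_ideal \<chi> b c +>\<^bsub>free_ring\<^esub> p"
    by (simp add: p H_class_def)
  from I.a_repr_independence[OF this _ I.a_subgroup] show ?thesis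
    by (simp add: p H_class_def free_ring_def)
qed

lemma scalar_mult_commute: "p * scalar a = scalar a * p"
  by (induction p rule: poly_mapping_add_single_induct)
     (auto simp: scalar_def distrib_left distrib_right mult_single mult.commute)

lemma scalar_mult: "scalar (a * d) = scalar a * scalar d"
  by (simp add: scalar_def mult_single)

lemma scalar_add: "scalar (a + d) = scalar a + scalar d"
  by (simp add: scalar_def single_add)

lemma scalar_1: "scalar 1 = 1"
  by (simp add: scalar_def)

locale H_module =
  fixes \<chi> :: "'g::ab_group_add \<Rightarrow> 'k::field" and b c :: 'g
    and M :: "(('g gen, 'k) free_algebra set, 'v) module"
  assumes left_module_M: "left_module (H_algebra \<chi> b c) M"
begin

sublocale left_module "H_algebra \<chi> b c" M
  by (rule left_module_M)

definition act :: "('g gen, 'k) free_algebra \<Rightarrow> 'v \<Rightarrow> 'v" where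
  "act p v = H_class \<chi> b c p \<odot>\<^bsub>M\<^esub> v"

lemma act_closed [simp]: "v \<in> carrier M \<Longrightarrow> act p v \<in> carrier M"
  by (simp add: act_def smult_closed H_class_closed)

lemma act_add_left: "v \<in> carrier M \<Longrightarrow> act (p + q) v = act p v \<oplus>\<^bsub>M\<^esub> act q v"
  by (simp add: act_def smult_l_distr H_class_closed H_class_add)

lemma act_add_right:
  "v \<in> carrier M \<Longrightarrow> w \<in> carrier M \<Longrightarrow> act p (v \<oplus>\<^bsub>M\<^esub> w) = act p v \<oplus>\<^bsub>M\<^esub> act p w"
  by (simp add: act_def smult_r_distr H_class_closed)

lemma act_mult: "v \<in> carrier M \<Longrightarrow> act (p * q) v = act p (act q v)"
  by (simp add: act_def smult_assoc H_class_closed H_class_mult)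

lemma act_1: "v \<in> carrier M \<Longrightarrow> act 1 v = v"
  by (simp add: act_def smult_one H_class_1)

lemma act_0: "v \<in> carrier M \<Longrightarrow> act 0 v = \<zero>\<^bsub>M\<^esub>"
  using act_add_left[of v 0 0] by (metis M.add.l_cancel_one' act_closed add.left_neutral)

lemma act_zero_right: "act p \<zero>\<^bsub>M\<^esub> = \<zero>\<^bsub>M\<^esub>"
  using act_add_right[of "\<zero>\<^bsub>M\<^esub>" "\<zero>\<^bsub>M\<^esub>" p]
  by (metis M.add.l_cancel_one' M.zero_closed M.l_zero act_closed)

lemma act_finsum:
  assumes "finite A" "t \<in> A \<rightarrow> carrier M"
  shows "act p (\<Oplus>\<^bsub>M\<^esub>i\<in>A. t i) = (\<Oplus>\<^bsub>M\<^esub>i\<in>A. act p (t i))"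
  using assms
proof (induction A rule: finite_induct)
  case (insert i A)
  then have "(\<lambda>i. act p (t i)) \<in> A \<rightarrow> carrier M" by (auto simp: Pi_iff)
  moreover have "t i \<in> carrier M" "t \<in> A \<rightarrow> carrier M" using insert by auto
  ultimately show ?case using insert by (simp add: act_add_right)
qed (simp add: act_zero_right)

lemma act_relator:
  assumes "p \<in> H_relators \<chi> b c" "v \<in> carrier M"
  shows "act p v = \<zero>\<^bsub>M\<^esub>"
  using act_0[OF assms(2)] by (simp add: act_def H_class_relator[OF assms(1)])

end

lemma module_isomorphic_trans:
  assumes "module_isomorphic R M N" "module_isomorphic R N P"
  shows "module_isomorphic R M P"
proof -
  obtain f where f: "bij_betw f (carrier M) (carrier N)"
      "\<forall>v\<in>carrier M. \<forall>w\<in>carrier M. f (v \<oplus>\<^bsub>M\<^esub> w) = f v \<oplus>\<^bsub>N\<^esub> f w"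
      "\<forall>a\<in>carrier R. \<forall>v\<in>carrier M. f (a \<odot>\<^bsub>M\<^esub> v) = a \<odot>\<^bsub>N\<^esub> f v"
    using assms(1) unfolding module_isomorphic_def by blast
  obtain g where g: "bij_betw g (carrier N) (carrier P)"
      "\<forall>v\<in>carrier N. \<forall>w\<in>carrier N. g (v \<oplus>\<^bsub>N\<^esub> w) = g v \<oplus>\<^bsub>P\<^esub> g w"
      "\<forall>a\<in>carrier R. \<forall>v\<in>carrier N. g (a \<odot>\<^bsub>N\<^esub> v) = a \<odot>\<^bsub>P\<^esub> g v"
    using assms(2) unfolding module_isomorphic_def by blast
  have "f v \<in> carrier N" if "v \<in> carrier M" for v
    using f(1) that by (auto simp: bij_betw_def)
  then show ?thesis
    unfolding module_isomorphic_def using bij_betw_trans[OF f(1) g(1)] f g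
    by (intro exI[of _ "g \<circ> f"]) simp
qed

lemma module_isomorphic_sym:
  assumes "left_module R M" "module_isomorphic R M N"
  shows "module_isomorphic R N M"
proof -
  interpret left_module R M by fact
  obtain f where f: "bij_betw f (carrier M) (carrier N)"
      "\<forall>v\<in>carrier M. \<forall>w\<in>carrier M. f (v \<oplus>\<^bsub>M\<^esub> w) = f v \<oplus>\<^bsub>N\<^esub> f w"
      "\<forall>a\<in>carrier R. \<forall>v\<in>carrier M. f (a \<odot>\<^bsub>M\<^esub> v) = a \<odot>\<^bsub>N\<^esub> f v"
    using assms(2) unfolding module_isomorphic_def by blast
  define g where "g = the_inv_into (carrier M) f"
  have inj: "inj_on f (carrier M)" and img: "f ` carrier M = carrier N"
    using f(1) by (auto simp: bij_betw_def)
  have gf: "g (f v) = v" if "v \<in> carrier M" for v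
    unfolding g_def using inj that by (rule the_inv_into_f_f)
  have "g (f v \<oplus>\<^bsub>N\<^esub> f w) = v \<oplus>\<^bsub>M\<^esub> w" if "v \<in> carrier M" "w \<in> carrier M" for v w
    using gf[of "v \<oplus>\<^bsub>M\<^esub> w"] f(2) that by simp
  moreover have "g (a \<odot>\<^bsub>N\<^esub> f v) = a \<odot>\<^bsub>M\<^esub> v" if "a \<in> carrier R" "v \<in> carrier M" for a v
    using gf[OF smult_closed[OF that]] f(3) that by simp
  moreover have "bij_betw g (carrier N) (carrier M)"
    unfolding g_def using f(1) by (rule bij_betw_the_inv_into)
  ultimately show ?thesis
    unfolding module_isomorphic_def
    by (intro exI[of _ g]) (auto simp: gf simp flip: img)
qed

section \<open>Coordinates identify a module with the model on functions\<close>

lemma Vx_module_carrier: "f \<in> carrier (Vx_module n \<chi> b c \<rho> l \<mu>) \<longleftrightarrow> (\<forall>i\<ge>n. f i = 0)"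
  by (simp add: Vx_module_def)

lemma Vx_module_add: "f \<oplus>\<^bsub>Vx_module n \<chi> b c \<rho> l \<mu>\<^esub> g = (\<lambda>i. f i + g i)"
  by (simp add: Vx_module_def)

lemma Vx_gen_closed:
  "Vx_gen n \<chi> b c \<rho> l \<mu> s f \<in> carrier (Vx_module n \<chi>' b' c' \<rho>' l' \<mu>')"
  by (simp add: Vx_module_carrier Vx_gen_def)

text \<open>
  The free algebra acts on functions by \<^const>\<open>Vx_act\<close> whether or not the relations of \<open>H\<close> hold there,
  so a linear map that respects the generators respects all of the free algebra, for every choice of
  the parameters.  It is this form, with a representative \<open>p\<close> instead of its class, that later detects
  relations which the action on functions might violate.
\<close>

lemma (in H_module) intertwining_generators:
  fixes F :: "(nat \<Rightarrow> 'k) \<Rightarrow> 'v" and n \<rho> l \<mu>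
  defines "V \<equiv> Vx_module n \<chi> b c \<rho> l \<mu>"
  assumes closed: "\<And>f. f \<in> carrier V \<Longrightarrow> F f \<in> carrier M"
    and add: "\<And>f g. f \<in> carrier V \<Longrightarrow> g \<in> carrier V \<Longrightarrow> F (\<lambda>i. f i + g i) = F f \<oplus>\<^bsub>M\<^esub> F g"
    and scale: "\<And>a f. f \<in> carrier V \<Longrightarrow> F (\<lambda>i. a * f i) = act (scalar a) (F f)"
    and gen: "\<And>s f. f \<in> carrier V \<Longrightarrow> F (Vx_gen n \<chi> b c \<rho> l \<mu> s f) = act (var s) (F f)"
    and f: "f \<in> carrier V"
  shows "F (Vx_act (Vx_gen n \<chi> b c \<rho> l \<mu>) p f) = act p (F f)"
proof (induction p rule: poly_mapping_add_single_induct)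
  case 1
  have "F (\<lambda>_. 0) = act 0 (F f)"
    using scale[OF f, of 0] by (simp add: scalar_def)
  then show ?case by (simp add: Vx_act_0)
next
  case (2 p u a)
  let ?G = "Vx_gen n \<chi> b c \<rho> l \<mu>"
  have word: "foldr ?G w f \<in> carrier V \<and> F (foldr ?G w f) = act (Poly_Mapping.single (Word w) 1) (F f)"
    for w
  proof (induction w)
    case Nil
    have "Poly_Mapping.single (Word []) 1 = (1 :: ('g gen, 'k) free_algebra)"
      by (simp add: scalar_1[symmetric] scalar_def zero_free_monoid_def)
    then show ?case using f closed by (simp add: act_1)
  next
    case (Cons s w)
    have "Poly_Mapping.single (Word (s # w)) 1 = var s * Poly_Mapping.single (Word w) (1 :: 'k)"
      by (simp add: var_def mult_single plus_free_monoid_def)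
    then show ?case
      using Cons f closed gen by (simp add: act_mult V_def Vx_gen_closed)
  qed
  have u: "Poly_Mapping.single u a = scalar a * Poly_Mapping.single (Word (letters u)) 1"
    by (simp add: scalar_def mult_single)
  have "Vx_act ?G p f \<in> carrier V"
    using f unfolding V_def by (rule Vx_act_closed)
  moreover have "(\<lambda>i. a * foldr ?G (letters u) f i) \<in> carrier V"
    using word[of "letters u"] by (simp add: V_def Vx_module_carrier)
  ultimately have "F (Vx_act ?G (p + Poly_Mapping.single u a) f) =
      F (Vx_act ?G p f) \<oplus>\<^bsub>M\<^esub> F (\<lambda>i. a * foldr ?G (letters u) f i)"
    by (simp add: Vx_act_add_left Vx_act_single add)
  also have "\<dots> = act p (F f) \<oplus>\<^bsub>M\<^esub> act (Poly_Mapping.single u a) (F f)"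
    using word[of "letters u"] f closed by (simp add: 2 scale u act_mult)
  finally show ?case
    using f closed by (simp add: act_add_left)
qed

text \<open>
  Only the target is known to be a module here: the action in \<^const>\<open>Vx_module\<close> may depend on the choice
  of representatives as long as \<open>\<rho>([e]\<^sub>n) = 0\<close> is not known, but \<open>F\<close> intertwines it for any choice.
\<close>

lemma (in H_module) isomorphic_if_intertwining_generators:
  fixes F :: "(nat \<Rightarrow> 'k) \<Rightarrow> 'v" and n \<rho> l \<mu>
  defines "V \<equiv> Vx_module n \<chi> b c \<rho> l \<mu>"
  assumes bij: "bij_betw F (carrier V) (carrier M)"
    and add: "\<And>f g. f \<in> carrier V \<Longrightarrow> g \<in> carrier V \<Longrightarrow> F (\<lambda>i. f i + g i) = F f \<oplus>\<^bsub>M\<^esub> F g"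
    and scale: "\<And>a f. f \<in> carrier V \<Longrightarrow> F (\<lambda>i. a * f i) = act (scalar a) (F f)"
    and gen: "\<And>s f. f \<in> carrier V \<Longrightarrow> F (Vx_gen n \<chi> b c \<rho> l \<mu> s f) = act (var s) (F f)"
  shows "module_isomorphic (H_algebra \<chi> b c) V M"
  unfolding module_isomorphic_def
proof (intro exI[of _ F] conjI ballI)
  fix h f
  assume h: "h \<in> carrier (H_algebra \<chi> b c)" and f: "f \<in> carrier V"
  have closed: "F f \<in> carrier M" if "f \<in> carrier V" for f
    using bij that by (auto simp: bij_betw_def)
  have "F (h \<odot>\<^bsub>V\<^esub> f) = F (Vx_act (Vx_gen n \<chi> b c \<rho> l \<mu>) (SOME p. p \<in> h) f)"
    by (simp add: V_def Vx_module_def)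
  also have "\<dots> = act (SOME p. p \<in> h) (F f)"
    by (rule intertwining_generators) (use closed add scale gen f in \<open>simp_all add: V_def\<close>)
  also have "\<dots> = h \<odot>\<^bsub>M\<^esub> F f"
    by (simp add: act_def H_class_some[OF h])
  finally show "F (h \<odot>\<^bsub>V\<^esub> f) = h \<odot>\<^bsub>M\<^esub> F f" .
qed (use bij add in \<open>simp_all add: V_def Vx_module_add\<close>)

context H_module
begin

definition lin_comb :: "nat \<Rightarrow> (nat \<Rightarrow> 'v) \<Rightarrow> (nat \<Rightarrow> 'k) \<Rightarrow> 'v" where
  "lin_comb n v a = (\<Oplus>\<^bsub>M\<^esub>i\<in>{..<n}. act (scalar (a i)) (v i))"

lemma lin_comb_closed:
  assumes "\<And>i. i < n \<Longrightarrow> v i \<in> carrier M"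
  shows "lin_comb n v a \<in> carrier M"
  unfolding lin_comb_def using assms by (intro M.finsum_closed) auto

lemma lin_comb_add:
  assumes "\<And>i. i < n \<Longrightarrow> v i \<in> carrier M"
  shows "lin_comb n v (\<lambda>i. a i + a' i) = lin_comb n v a \<oplus>\<^bsub>M\<^esub> lin_comb n v a'"
proof -
  have "lin_comb n v (\<lambda>i. a i + a' i) =
      (\<Oplus>\<^bsub>M\<^esub>i\<in>{..<n}. act (scalar (a i)) (v i) \<oplus>\<^bsub>M\<^esub> act (scalar (a' i)) (v i))"
    unfolding lin_comb_def using assms by (intro M.finsum_cong') (auto simp: scalar_add act_add_left)
  also have "\<dots> = lin_comb n v a \<oplus>\<^bsub>M\<^esub> lin_comb n v a'"
    unfolding lin_comb_def using assms by (intro M.finsum_addf) auto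
  finally show ?thesis .
qed

text \<open>
  An element that permutes the vectors \<open>v i\<close> up to scalars acts on coordinates by the corresponding
  monomial matrix.  All generators of \<open>H\<close>, and all scalars, are of this kind on \<open>V\<^sub>x\<close>.
\<close>

lemma act_lin_comb_monomial:
  assumes v: "\<And>i. i < n \<Longrightarrow> v i \<in> carrier M"
    and \<pi>: "bij_betw \<pi> {..<n} {..<n}"
    and p: "\<And>i. i < n \<Longrightarrow> act p (v i) = act (scalar (d i)) (v (\<pi> i))"
    and h: "\<And>i. i < n \<Longrightarrow> h (\<pi> i) = d i * a i"
  shows "lin_comb n v h = act p (lin_comb n v a)"
proof -
  have \<pi>_less: "\<pi> i < n" if "i < n" for i
    using \<pi> that by (auto simp: bij_betw_def)
  have term_eq: "act (scalar (h (\<pi> i))) (v (\<pi> i)) = act p (act (scalar (a i)) (v i))"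
    if "i < n" for i
  proof -
    have "act p (act (scalar (a i)) (v i)) = act (scalar (a i)) (act p (v i))"
      using v[OF that] by (simp add: scalar_mult_commute flip: act_mult)
    also have "\<dots> = act (scalar (h (\<pi> i))) (v (\<pi> i))"
      using v[OF \<pi>_less[OF that]] that
      by (simp add: p h mult.commute[of "d i"] scalar_mult act_mult)
    finally show ?thesis by simp
  qed
  have "lin_comb n v h = (\<Oplus>\<^bsub>M\<^esub>i\<in>\<pi> ` {..<n}. act (scalar (h i)) (v i))"
    using \<pi> by (simp add: lin_comb_def bij_betw_def)
  also have "\<dots> = (\<Oplus>\<^bsub>M\<^esub>i\<in>{..<n}. act (scalar (h (\<pi> i))) (v (\<pi> i)))"
    using v \<pi> by (intro M.finsum_reindex) (auto simp: bij_betw_def)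
  also have "\<dots> = (\<Oplus>\<^bsub>M\<^esub>i\<in>{..<n}. act p (act (scalar (a i)) (v i)))"
    using v by (intro M.finsum_cong') (auto simp: term_eq)
  also have "\<dots> = act p (lin_comb n v a)"
    unfolding lin_comb_def using v by (intro act_finsum[symmetric]) auto
  finally show ?thesis .
qed

lemma bij_betw_lin_comb:
  assumes "is_basis_of \<chi> b c M n v"
  shows "bij_betw (lin_comb n v) (carrier (Vx_module n \<chi> b c \<rho> l \<mu>)) (carrier M)"
proof -
  have v: "\<And>i. i < n \<Longrightarrow> v i \<in> carrier M"
    and ex1: "\<And>w. w \<in> carrier M \<Longrightarrow> \<exists>!a. (\<forall>i\<ge>n. a i = 0) \<and> w = lin_comb n v a"
    using assms by (auto simp: is_basis_of_def lin_comb_def act_def)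
  have "inj_on (lin_comb n v) (carrier (Vx_module n \<chi> b c \<rho> l \<mu>))"
    using ex1[OF lin_comb_closed[of n v, OF v]] by (intro inj_onI) (auto simp: Vx_module_carrier)
  moreover have "lin_comb n v ` carrier (Vx_module n \<chi> b c \<rho> l \<mu>) = carrier M"
    using ex1 lin_comb_closed[of n v, OF v] by (fastforce simp: Vx_module_carrier)
  ultimately show ?thesis by (simp add: bij_betw_def)
qed

end

context H_module
begin

text \<open>
  Each formula in the definition of \<open>V\<^sub>x\<close> sends \<open>v\<^sub>i\<close> to a multiple of \<open>v\<^sub>i\<close>, \<open>v\<^sub>i\<^sub>+\<^sub>1\<close> or \<open>v\<^sub>i\<^sub>-\<^sub>1\<close> (indices modulo
  \<open>n\<close>), while \<^const>\<open>Vx_gen\<close> lists the resulting coefficients by their target index.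
\<close>

lemma lin_comb_Vx_gen:
  assumes chi: "\<chi> \<in> carrier dual_group" and n: "0 < n"
    and v: "\<And>i. i < n \<Longrightarrow> v i \<in> carrier M"
    and x: "\<And>i. i + 1 < n \<Longrightarrow> act (var Gx) (v i) = v (i + 1)"
    and x_last: "act (var Gx) (v (n - 1)) = act (scalar l) (v 0)"
    and y_0: "act (var Gy) (v 0) = act (scalar (inverse l * \<mu>)) (v (n - 1))"
    and y: "\<And>i. 1 \<le> i \<Longrightarrow> i < n \<Longrightarrow> act (var Gy) (v i) =
      act (scalar (\<mu> + extend_char \<rho> (sigma_bracket \<chi> i (e_elt b c)))) (v (i - 1))"
    and grp: "\<And>g i. i < n \<Longrightarrow> act (var (Grp g)) (v i) = act (scalar
      (extend_char \<rho> ((inv_into UNIV (sigma \<chi>) ^^ i) (Poly_Mapping.single g 1)))) (v i)"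
  shows "lin_comb n v (Vx_gen n \<chi> b c \<rho> l \<mu> s a) = act (var s) (lin_comb n v a)"
proof (cases s)
  case (Grp g)
  show ?thesis
    by (rule act_lin_comb_monomial[where \<pi> = "\<lambda>i. i" and d = "\<lambda>i. \<rho> g * inverse (\<chi> g) ^ i"])
       (use v in \<open>auto simp: bij_betw_def Grp grp Vx_gen_def extend_char_inv_sigma_funpow[OF chi]\<close>)
next
  case Gx
  have "bij_betw (\<lambda>i. if i = n - 1 then 0 else i + 1) {..<n} {..<n}"
    by (rule bij_betw_byWitness[where f' = "\<lambda>i. if i = 0 then n - 1 else i - 1"]) (use n in auto)
  then show ?thesis
    by (rule act_lin_comb_monomial[where d = "\<lambda>i. if i = n - 1 then l else 1", rotated])
       (use n v x x_last in \<open>auto simp: Gx Vx_gen_def scalar_1 act_1\<close>)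
next
  case Gy
  have "bij_betw (\<lambda>i. if i = 0 then n - 1 else i - 1) {..<n} {..<n}"
    by (rule bij_betw_byWitness[where f' = "\<lambda>i. if i = n - 1 then 0 else i + 1"]) (use n in auto)
  then show ?thesis
    by (rule act_lin_comb_monomial[where d = "\<lambda>i. if i = 0 then inverse l * \<mu> else
         \<mu> + extend_char \<rho> (sigma_bracket \<chi> i (e_elt b c))", rotated])
       (use n v y y_0 in \<open>auto simp: Gy Vx_gen_def\<close>)
qed

lemma is_Vx_coordinates:
  assumes chi: "\<chi> \<in> carrier dual_group" and n: "0 < n" and M: "is_Vx n \<chi> b c \<rho> l \<mu> M"
  obtains F where "bij_betw F (carrier (Vx_module n \<chi> b c \<rho> l \<mu>)) (carrier M)"
    and "\<And>f g. F (\<lambda>i. f i + g i) = F f \<oplus>\<^bsub>M\<^esub> F g"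
    and "\<And>a f. F (\<lambda>i. a * f i) = act (scalar a) (F f)"
    and "\<And>s f. F (Vx_gen n \<chi> b c \<rho> l \<mu> s f) = act (var s) (F f)"
proof -
  obtain v where basis: "is_basis_of \<chi> b c M n v"
    and x: "\<And>i. i + 1 < n \<Longrightarrow> act (var Gx) (v i) = v (i + 1)"
    and x_last: "act (var Gx) (v (n - 1)) = act (scalar l) (v 0)"
    and y_0: "act (var Gy) (v 0) = act (scalar (inverse l * \<mu>)) (v (n - 1))"
    and y: "\<And>i. 1 \<le> i \<Longrightarrow> i < n \<Longrightarrow> act (var Gy) (v i) =
      act (scalar (\<mu> + extend_char \<rho> (sigma_bracket \<chi> i (e_elt b c)))) (v (i - 1))"
    and grp: "\<And>g i. i < n \<Longrightarrow> act (var (Grp g)) (v i) = act (scalar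
      (extend_char \<rho> ((inv_into UNIV (sigma \<chi>) ^^ i) (Poly_Mapping.single g 1)))) (v i)"
    using M unfolding is_Vx_def act_def by blast
  have v: "\<And>i. i < n \<Longrightarrow> v i \<in> carrier M"
    using basis by (simp add: is_basis_of_def)
  show ?thesis
  proof (rule that[of "lin_comb n v"])
    show "lin_comb n v (\<lambda>i. a * f i) = act (scalar a) (lin_comb n v f)" for a f
      by (rule act_lin_comb_monomial[where \<pi> = "\<lambda>i. i" and d = "\<lambda>_. a"])
         (use v in \<open>auto simp: bij_betw_def\<close>)
    show "lin_comb n v (Vx_gen n \<chi> b c \<rho> l \<mu> s f) = act (var s) (lin_comb n v f)" for s f
      using chi n v x x_last y_0 y grp by (rule lin_comb_Vx_gen)
  qed (use v in \<open>auto intro: bij_betw_lin_comb[OF basis] lin_comb_add\<close>)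
qed

end

lemma Vx_module_isomorphic_is_Vx:
  assumes "\<chi> \<in> carrier dual_group" "0 < n" and M: "is_Vx n \<chi> b c \<rho> l \<mu> M"
  shows "module_isomorphic (H_algebra \<chi> b c) (Vx_module n \<chi> b c \<rho> l \<mu>) M"
proof -
  interpret H_module \<chi> b c M
    using M by (auto intro: H_module.intro simp: is_Vx_def)
  show ?thesis
    by (rule is_Vx_coordinates[OF assms], rule isomorphic_if_intertwining_generators)
qed

lemma Vx_gen_Gx_Gy:
  assumes "i < n" "l \<noteq> 0"
  shows "Vx_gen n \<chi> b c \<rho> l \<mu> Gx (Vx_gen n \<chi> b c \<rho> l \<mu> Gy f) i =
    (\<mu> + extend_char \<rho> (sigma_bracket \<chi> i (e_elt b c))) * f i"
  using assms by (auto simp: Vx_gen_def sigma_bracket_def)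

lemma Vx_act_lift_group_algebra:
  assumes "i < n"
  shows "Vx_act (Vx_gen n \<chi> b c \<rho> l \<mu>) (lift_group_algebra u) f i =
    extend_char (\<lambda>g. \<rho> g * inverse (\<chi> g) ^ i) u * f i"
  using assms
  by (simp add: lift_group_algebra_def Vx_act_sum_left Vx_act_mult Vx_act_scalar Vx_act_var
      Vx_gen_def extend_char_def sum_distrib_left sum_distrib_right mult_ac)

text \<open>
  Both sides of \<open>yx = xy + e\<close> act on \<open>v\<^sub>n\<^sub>-\<^sub>1\<close> by a scalar: \<open>yx\<close> by \<open>\<mu>\<close>, since \<open>x v\<^sub>n\<^sub>-\<^sub>1 = l v\<^sub>0\<close> and
  \<open>y v\<^sub>0 = l\<^sup>-\<^sup>1 \<mu> v\<^sub>n\<^sub>-\<^sub>1\<close>, and \<open>xy + e\<close> by \<open>\<mu> + \<rho>([e]\<^sub>n\<^sub>-\<^sub>1) + \<rho>(\<sigma>\<^sup>-\<^sup>(\<^sup>n\<^sup>-\<^sup>1\<^sup>)(e)) = \<mu> + \<rho>([e]\<^sub>n)\<close>.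
\<close>

lemma is_Vx_bracket_n_eq_0:
  assumes chi: "\<chi> \<in> carrier dual_group" and n: "0 < n" and l: "l \<noteq> 0"
    and M: "is_Vx n \<chi> b c \<rho> l \<mu> M"
  shows "extend_char \<rho> (sigma_bracket \<chi> n (e_elt b c)) = 0"
proof -
  interpret H_module \<chi> b c M
    using M by (auto intro: H_module.intro simp: is_Vx_def)
  let ?G = "Vx_gen n \<chi> b c \<rho> l \<mu>" and ?V = "Vx_module n \<chi> b c \<rho> l \<mu>"
  let ?p = "var Gy * var Gx - (var Gx * var Gy + lift_group_algebra (e_elt b c))"
  obtain F where F: "bij_betw F (carrier ?V) (carrier M)"
    "\<And>f g. F (\<lambda>i. f i + g i) = F f \<oplus>\<^bsub>M\<^esub> F g"
    "\<And>a f. F (\<lambda>i. a * f i) = act (scalar a) (F f)"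
    "\<And>s f. F (?G s f) = act (var s) (F f)"
    using is_Vx_coordinates[OF chi n M] by blast
  have closed: "F f \<in> carrier M" if "f \<in> carrier ?V" for f
    using F(1) that by (auto simp: bij_betw_def)
  \<comment> \<open>The coordinate function of \<open>v\<^sub>n\<^sub>-\<^sub>1\<close>.\<close>
  define f where "f = (\<lambda>i::nat. if i = n - 1 then 1 else 0 :: 'b)"
  have f: "f \<in> carrier ?V"
    using n by (auto simp: f_def Vx_module_carrier)
  have Vx_act_F: "F (Vx_act ?G p f) = act p (F f)" for p
    by (rule intertwining_generators) (use F closed f in auto)
  \<comment> \<open>The relator vanishes in \<open>M\<close>, and \<open>F\<close> is injective, so it vanishes on \<open>f\<close>.\<close>
  have "?p \<in> H_relators \<chi> b c"
    by (simp add: H_relators_def)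
  then have "act ?p (F f) = act 0 (F f)"
    using closed[OF f] by (simp add: act_relator act_0)
  then have "F (Vx_act ?G ?p f) = F (Vx_act ?G 0 f)"
    by (simp only: Vx_act_F)
  then have "Vx_act ?G ?p f = Vx_act ?G 0 f"
    using bij_betw_imp_inj_on[OF F(1)] Vx_act_closed[OF f] by (auto dest: inj_onD)
  then have "Vx_act ?G ?p f (n - 1) = 0"
    by (simp add: Vx_act_0)
  moreover have "?G Gy (?G Gx f) (n - 1) = \<mu>"
    using n l by (simp add: Vx_gen_def f_def)
  moreover have "extend_char \<rho> (sigma_bracket \<chi> n (e_elt b c)) =
      extend_char \<rho> (sigma_bracket \<chi> (n - 1) (e_elt b c)) +
      extend_char (\<lambda>g. \<rho> g * inverse (\<chi> g) ^ (n - 1)) (e_elt b c)"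
    using extend_char_bracket_Suc[OF chi, of \<rho> "n - 1"] n by simp
  ultimately show ?thesis
    using n l by (simp add: Vx_act_diff_left Vx_act_add_left Vx_act_mult Vx_act_var
        Vx_act_lift_group_algebra Vx_gen_Gx_Gy) (simp add: f_def)
qed

section \<open>Multiplication by x shifts the parameters\<close>

text \<open>
  Multiplication by \<open>x\<close> on \<open>V\<^sub>x(\<rho>, l, \<mu>)\<close> satisfies \<open>g x = x (\<chi>(g)\<^sup>-\<^sup>1 g)\<close> and \<open>y x = x y + e\<close>.  So
  after it, \<open>g\<close> acts as \<open>\<chi>(g)\<^sup>-\<^sup>1 g\<close> did before, which replaces \<open>\<rho>\<close> by \<open>\<rho> \<chi>\<^sup>-\<^sup>1\<close>, and the eigenvalue
  \<open>\<mu> + \<rho>([e]\<^sub>i)\<close> of \<open>xy\<close> on \<open>v\<^sub>i\<close> becomes the eigenvalue \<open>\<mu> + \<rho>([e]\<^sub>i\<^sub>+\<^sub>1)\<close> of \<open>yx\<close>.  At \<open>i = n - 1\<close> the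
  index wraps around to \<open>0\<close>, which is consistent exactly because \<open>\<rho>([e]\<^sub>n) = 0\<close>.
\<close>

lemma Vx_module_isomorphic_twist:
  assumes chi: "\<chi> \<in> carrier dual_group" and rho: "\<rho> \<in> carrier dual_group"
    and n: "n = group.ord dual_group \<chi>" "0 < n" and l: "l \<noteq> 0"
    and B0: "extend_char \<rho> (sigma_bracket \<chi> n (e_elt b c)) = 0"
  shows "module_isomorphic (H_algebra \<chi> b c)
    (Vx_module n \<chi> b c (\<lambda>g. \<rho> g * inverse (\<chi> g)) l (\<mu> + extend_char \<rho> (e_elt b c)))
    (Vx_module n \<chi> b c \<rho> l \<mu>)"
proof -
  let ?\<rho>' = "\<lambda>g. \<rho> g * inverse (\<chi> g)" and ?\<mu>' = "\<mu> + extend_char \<rho> (e_elt b c)"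
  let ?G = "Vx_gen n \<chi> b c \<rho> l \<mu>" and ?G' = "Vx_gen n \<chi> b c ?\<rho>' l ?\<mu>'"
  let ?V = "Vx_module n \<chi> b c \<rho> l \<mu>" and ?V' = "Vx_module n \<chi> b c ?\<rho>' l ?\<mu>'"
  let ?B = "\<lambda>i. extend_char \<rho> (sigma_bracket \<chi> i (e_elt b c))"
  interpret H_module \<chi> b c ?V
    using is_Vx_Vx_module[OF assms] by (auto intro: H_module.intro simp: is_Vx_def)
  have act: "act p f = Vx_act ?G p f" if "f \<in> carrier ?V" for p f
    unfolding act_def using assms that by (rule Vx_smult_class)
  have same_carrier: "f \<in> carrier ?V' \<longleftrightarrow> f \<in> carrier ?V" for f
    by (simp add: Vx_module_carrier)
  have bracket: "\<mu> + ?B (Suc i) = ?\<mu>' + extend_char ?\<rho>' (sigma_bracket \<chi> i (e_elt b c))" for i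
    using extend_char_bracket_add[OF chi, of \<rho> 1 i] by (simp add: sigma_bracket_def)
  \<comment> \<open>The factor that \<open>\<chi>\<^sup>-\<^sup>1\<close> contributes when \<open>x\<close> wraps \<open>v\<^sub>n\<^sub>-\<^sub>1\<close> around to \<open>l v\<^sub>0\<close>.\<close>
  have pown: "inverse (\<chi> g) * inverse (\<chi> g) ^ (n - 1) = 1" for g
  proof -
    have "inverse (\<chi> g) ^ n = 1"
      by (simp add: n(1) power_inverse dual_group_pow_ord[OF chi])
    then show ?thesis using n(2) by (cases n) auto
  qed
  show ?thesis
  proof (rule isomorphic_if_intertwining_generators[where F = "?G Gx"])
    show "bij_betw (?G Gx) (carrier ?V') (carrier ?V)"
      by (rule bij_betw_byWitness[where f' = "\<lambda>f i. if i \<ge> n then 0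
             else if i = n - 1 then inverse l * f 0 else f (i + 1)"])
         (use n(2) l in \<open>auto simp: Vx_module_carrier Vx_gen_def fun_eq_iff le_Suc_eq not_le\<close>)
  next
    fix s f
    assume "f \<in> carrier ?V'"
    then have f: "f \<in> carrier ?V" by (simp add: same_carrier)
    have "?G Gx (?G' s f) i = ?G s (?G Gx f) i" for i
    proof (cases "i < n")
      case True
      show ?thesis
      proof (cases s)
        case (Grp g)
        have "inverse (\<chi> g) ^ i = inverse (\<chi> g) * inverse (\<chi> g) ^ (i - 1)" if "i > 0"
          using that by (cases i) auto
        then show ?thesis
          using True n(2) pown[of g] by (auto simp: Grp Vx_gen_def mult_ac)
      next
        case Gx
        then show ?thesis using True by (auto simp: Vx_gen_def)
      next
        case Gy
        have "?G Gy (?G Gx f) i = (\<mu> + ?B (Suc i)) * f i"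
          using True n(2) l B0 by (auto simp: Vx_gen_def)
        \<comment> \<open>The action of \<open>x\<close> depends only on \<open>l\<close>, so the eigenvalue of \<open>xy\<close> for the twisted parameters applies.\<close>
        moreover have "?G Gx (?G' Gy f) i = ?G' Gx (?G' Gy f) i"
          by (simp add: Vx_gen_def)
        ultimately show ?thesis
          using True l by (simp add: Gy Vx_gen_Gx_Gy bracket)
      qed
    qed (simp add: Vx_gen_def)
    then show "?G Gx (?G' s f) = act (var s) (?G Gx f)"
      by (simp add: act Vx_gen_closed Vx_act_var fun_eq_iff)
  qed (auto simp: act Vx_gen_closed Vx_gen_add Vx_gen_scale Vx_module_add Vx_act_scalar)
qed

lemma Vx_module_isomorphic_twist_power:
  assumes chi: "\<chi> \<in> carrier dual_group" and rho: "\<rho> \<in> carrier dual_group"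
    and n: "n = group.ord dual_group \<chi>" "0 < n" and l: "l \<noteq> 0"
    and B0: "extend_char \<rho> (sigma_bracket \<chi> n (e_elt b c)) = 0"
  shows "module_isomorphic (H_algebra \<chi> b c)
    (Vx_module n \<chi> b c (\<lambda>g. \<rho> g * inverse (\<chi> g) ^ k) l
      (\<mu> + extend_char \<rho> (sigma_bracket \<chi> k (e_elt b c))))
    (Vx_module n \<chi> b c \<rho> l \<mu>)"
proof (induction k)
  case 0
  show ?case
    unfolding module_isomorphic_def by (intro exI[of _ "\<lambda>f. f"]) (simp add: sigma_bracket_def bij_betw_def)
next
  case (Suc k)
  let ?\<rho> = "\<lambda>g. \<rho> g * inverse (\<chi> g) ^ k"
  have "extend_char ?\<rho> (sigma_bracket \<chi> n (e_elt b c)) = 0"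
    using extend_char_bracket_n_shift[OF chi n(1)] B0 by metis
  from Vx_module_isomorphic_twist[OF chi dual_group_twist_closed[OF chi rho] n l this,
    of "\<mu> + extend_char \<rho> (sigma_bracket \<chi> k (e_elt b c))"]
  have "module_isomorphic (H_algebra \<chi> b c)
      (Vx_module n \<chi> b c (\<lambda>g. \<rho> g * inverse (\<chi> g) ^ Suc k) l
        (\<mu> + extend_char \<rho> (sigma_bracket \<chi> (Suc k) (e_elt b c))))
      (Vx_module n \<chi> b c ?\<rho> l (\<mu> + extend_char \<rho> (sigma_bracket \<chi> k (e_elt b c))))"
    by (simp only: extend_char_bracket_Suc[OF chi] power_Suc2 mult.assoc add.assoc)
  then show ?case using Suc.IH by (rule module_isomorphic_trans)
qed

section \<open>Eigenvalues recover the parameters\<close>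

text \<open>
  For \<open>j = n\<close> this says that \<open>x\<^sup>n\<close> acts as the scalar \<open>l\<close>.
\<close>

lemma Vx_gen_Gx_funpow:
  assumes f: "f \<in> carrier (Vx_module n \<chi> b c \<rho> l \<mu>)" and "j \<le> n"
  shows "(Vx_gen n \<chi> b c \<rho> l \<mu> Gx ^^ j) f i =
    (if i \<ge> n then 0 else if i < j then l * f (n + i - j) else f (i - j))"
proof -
  define X where "X = Vx_gen n \<chi> b c \<rho> l \<mu> Gx"
  have X: "X h i = (if i \<ge> n then 0 else if i = 0 then l * h (n - 1) else h (i - 1))" for h i
    by (simp add: X_def Vx_gen_def)
  have "(X ^^ j) f i = (if i \<ge> n then 0 else if i < j then l * f (n + i - j) else f (i - j))"
    using \<open>j \<le> n\<close>
  proof (induction j arbitrary: i)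
    case 0
    then show ?case using f by (simp add: Vx_module_carrier)
  next
    case (Suc j)
    then show ?case
      by (cases i) (auto simp: X)
  qed
  then show ?thesis by (simp add: X_def)
qed

text \<open>
  The image of \<open>v\<^sub>0\<close> is a common eigenvector of \<open>G\<close>, \<open>xy\<close> and \<open>x\<^sup>n\<close>, which all act diagonally on the
  second module.  Its eigenvalues are thus the diagonal entries at any of its nonzero coordinates.
\<close>

lemma Vx_module_isomorphic_imp:
  fixes \<chi> \<rho>1 \<rho>2 :: "'g::ab_group_add \<Rightarrow> 'k::field"
  assumes chi: "\<chi> \<in> carrier dual_group" and n: "n = group.ord dual_group \<chi>" "0 < n"
    and rho: "\<rho>1 \<in> carrier dual_group" "\<rho>2 \<in> carrier dual_group"
    and l: "l1 \<noteq> 0" "l2 \<noteq> 0"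
    and B0: "extend_char \<rho>1 (sigma_bracket \<chi> n (e_elt b c)) = 0"
      "extend_char \<rho>2 (sigma_bracket \<chi> n (e_elt b c)) = 0"
    and iso: "module_isomorphic (H_algebra \<chi> b c)
      (Vx_module n \<chi> b c \<rho>1 l1 \<mu>1) (Vx_module n \<chi> b c \<rho>2 l2 \<mu>2)"
  shows "\<exists>k<n. l1 = l2 \<and> \<rho>1 = (\<lambda>g. \<rho>2 g * inverse (\<chi> g) ^ k) \<and>
    \<mu>1 = \<mu>2 + extend_char \<rho>2 (sigma_bracket \<chi> k (e_elt b c))"
proof -
  let ?G1 = "Vx_gen n \<chi> b c \<rho>1 l1 \<mu>1" and ?V1 = "Vx_module n \<chi> b c \<rho>1 l1 \<mu>1"
  let ?G2 = "Vx_gen n \<chi> b c \<rho>2 l2 \<mu>2" and ?V2 = "Vx_module n \<chi> b c \<rho>2 l2 \<mu>2"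
  obtain F where bij: "bij_betw F (carrier ?V1) (carrier ?V2)"
    and F_smult: "\<forall>h\<in>carrier (H_algebra \<chi> b c). \<forall>f\<in>carrier ?V1. F (h \<odot>\<^bsub>?V1\<^esub> f) = h \<odot>\<^bsub>?V2\<^esub> F f"
    using iso unfolding module_isomorphic_def by blast
  have closed: "F f \<in> carrier ?V2" if "f \<in> carrier ?V1" for f
    using bij that by (auto simp: bij_betw_def)
  have F_act: "F (Vx_act ?G1 p f) = Vx_act ?G2 p (F f)" if f: "f \<in> carrier ?V1" for p f
    using F_smult H_class_closed[of \<chi> b c p] f closed[OF f]
    by (metis Vx_smult_class[OF chi rho(1) n l(1) B0(1)] Vx_smult_class[OF chi rho(2) n l(2) B0(2)])
  have F_gen: "F (?G1 s f) = ?G2 s (F f)" if "f \<in> carrier ?V1" for s f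
    using F_act[OF that, of "var s"] by (simp add: Vx_act_var)
  have F_scale: "F (\<lambda>i. a * f i) = (\<lambda>i. a * F f i)" if "f \<in> carrier ?V1" for a f
    using F_act[OF that, of "scalar a"] by (simp add: Vx_act_scalar)
  \<comment> \<open>The coordinate function of \<open>v\<^sub>0\<close>.\<close>
  define f where "f = (\<lambda>i::nat. if i = 0 then 1 else 0 :: 'k)"
  have f: "f \<in> carrier ?V1"
    using n(2) by (auto simp: f_def Vx_module_carrier)
  define w where "w = F f"
  have w: "w \<in> carrier ?V2"
    unfolding w_def using f by (rule closed)
  have "\<exists>k. w k \<noteq> 0"
  proof (rule ccontr)
    assume "\<not> (\<exists>k. w k \<noteq> 0)"
    then have "F f = F (\<lambda>i. 0 * f i)"
      by (simp only: F_scale[OF f]) (simp add: w_def fun_eq_iff)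
    then have "f = (\<lambda>i. 0 * f i)"
      using bij_betw_imp_inj_on[OF bij] f by (auto dest!: inj_onD simp: Vx_module_carrier)
    from fun_cong[OF this, of 0] show False by (simp add: f_def)
  qed
  then obtain k where k: "w k \<noteq> 0" by blast
  with w have kn: "k < n" by (auto simp: Vx_module_carrier not_less[symmetric])
  have eigenvalue: "F (\<lambda>i. a * f i) k = a * w k" for a
    by (simp add: F_scale[OF f] w_def)
  have "\<rho>1 g = \<rho>2 g * inverse (\<chi> g) ^ k" for g
  proof -
    have "?G1 (Grp g) f = (\<lambda>i. \<rho>1 g * f i)"
      using n(2) by (auto simp: Vx_gen_def f_def fun_eq_iff le_Suc_eq not_le)
    then have "\<rho>1 g * w k = ?G2 (Grp g) w k"
      using F_gen[OF f, of "Grp g"] eigenvalue[of "\<rho>1 g"] by (simp add: w_def)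
    then show ?thesis using k kn by (simp add: Vx_gen_def)
  qed
  moreover have "\<mu>1 = \<mu>2 + extend_char \<rho>2 (sigma_bracket \<chi> k (e_elt b c))"
  proof -
    have "?G1 Gx (?G1 Gy f) i = \<mu>1 * f i" for i
    proof (cases "i < n")
      case True
      then show ?thesis using l by (auto simp: Vx_gen_Gx_Gy f_def sigma_bracket_def)
    qed (use n(2) in \<open>auto simp: Vx_gen_def f_def\<close>)
    then have "?G1 Gx (?G1 Gy f) = (\<lambda>i. \<mu>1 * f i)" by blast
    moreover have "F (?G1 Gx (?G1 Gy f)) = ?G2 Gx (?G2 Gy w)"
      by (simp add: w_def F_gen f Vx_gen_closed)
    ultimately have "\<mu>1 * w k = ?G2 Gx (?G2 Gy w) k"
      using eigenvalue[of \<mu>1] by simp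
    then show ?thesis using k kn l by (simp add: Vx_gen_Gx_Gy)
  qed
  moreover have "l1 = l2"
  proof -
    have "(?G1 Gx ^^ j) f \<in> carrier ?V1 \<and> F ((?G1 Gx ^^ j) f) = (?G2 Gx ^^ j) w" for j
      by (induction j) (use f in \<open>auto simp: w_def F_gen Vx_gen_closed\<close>)
    moreover have "(?G1 Gx ^^ n) f = (\<lambda>i. l1 * f i)"
      using Vx_gen_Gx_funpow[OF f, of n] n(2) by (auto simp: fun_eq_iff f_def)
    ultimately have "l1 * w k = (?G2 Gx ^^ n) w k"
      using eigenvalue[of l1] by metis
    then show ?thesis
      using Vx_gen_Gx_funpow[OF w, of n] k kn by simp
  qed
  ultimately show ?thesis using kn by blast
qed

section \<open>The isomorphism criterion\<close>

theorem proposition5p13: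
  fixes \<chi> \<rho>1 \<rho>2 :: "'g::ab_group_add \<Rightarrow> 'k::{alg_closed_field, field_char_0}"
    and b c :: 'g
    and n :: nat
    and l1 l2 \<mu>1 \<mu>2 :: 'k
    and V1 :: "(('g gen, 'k) free_algebra set, 'v) module"
    and V2 :: "(('g gen, 'k) free_algebra set, 'w) module"
  assumes "finitely_generated TYPE('g)"
    and "\<chi> \<in> carrier dual_group"
    and "n = group.ord dual_group \<chi>" and "0 < n"
    and "\<chi> b = \<chi> c" and "b + c \<noteq> 0"
    and "\<rho>1 \<in> carrier dual_group" and "\<rho>2 \<in> carrier dual_group"
    and "l1 \<noteq> 0" and "l2 \<noteq> 0"
    and "is_Vx n \<chi> b c \<rho>1 l1 \<mu>1 V1"
    and "is_Vx n \<chi> b c \<rho>2 l2 \<mu>2 V2"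
  shows "module_isomorphic (H_algebra \<chi> b c) V1 V2 \<longleftrightarrow>
    (\<exists>k<n. l1 = l2 \<and>
      \<rho>1 = \<rho>2 \<otimes>\<^bsub>dual_group\<^esub> \<chi> [^]\<^bsub>dual_group\<^esub> (- int k) \<and>
      \<mu>1 = \<mu>2 + extend_char \<rho>2 (sigma_bracket \<chi> k (e_elt b c)))"
proof -
  let ?H = "H_algebra \<chi> b c"
  let ?W1 = "Vx_module n \<chi> b c \<rho>1 l1 \<mu>1" and ?W2 = "Vx_module n \<chi> b c \<rho>2 l2 \<mu>2"
  note chi = assms(2) and n = assms(3,4) and rho = assms(7,8) and l = assms(9,10)
  note B1 = is_Vx_bracket_n_eq_0[OF chi n(2) l(1) assms(11)]
    and B2 = is_Vx_bracket_n_eq_0[OF chi n(2) l(2) assms(12)]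
  note iso1 = Vx_module_isomorphic_is_Vx[OF chi n(2) assms(11)]
    and iso2 = Vx_module_isomorphic_is_Vx[OF chi n(2) assms(12)]
  have W: "left_module ?H ?W1" "left_module ?H ?W2"
    using is_Vx_Vx_module[OF chi rho(1) n l(1) B1] is_Vx_Vx_module[OF chi rho(2) n l(2) B2]
    by (simp_all add: is_Vx_def)
  have "module_isomorphic ?H V1 V2 \<longleftrightarrow> module_isomorphic ?H ?W1 ?W2"
    using iso1 iso2 module_isomorphic_sym[OF W(1) iso1] module_isomorphic_sym[OF W(2) iso2]
    by (meson module_isomorphic_trans)
  also have "\<dots> \<longleftrightarrow> (\<exists>k<n. l1 = l2 \<and> \<rho>1 = (\<lambda>g. \<rho>2 g * inverse (\<chi> g) ^ k) \<and>
      \<mu>1 = \<mu>2 + extend_char \<rho>2 (sigma_bracket \<chi> k (e_elt b c)))"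
    using Vx_module_isomorphic_imp[OF chi n rho l B1 B2]
      Vx_module_isomorphic_twist_power[OF chi rho(2) n l(2) B2] by blast
  also have "(\<lambda>k. \<lambda>g. \<rho>2 g * inverse (\<chi> g) ^ k) =
      (\<lambda>k. \<rho>2 \<otimes>\<^bsub>dual_group\<^esub> \<chi> [^]\<^bsub>dual_group\<^esub> (- int k))"
    by (simp add: dual_group_pow_minus[OF chi]) (simp add: dual_group_def)
  finally show ?thesis .
qed

end
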